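(* Let $X$ be a centered, nondegenerate, infinitely divisible real random variable with finite variance $V>0$. For $\theta\ge1$ let $t_\theta=\inf\{t>0:M_R(t)>\theta\}\in[0,\infty]$. For every $\theta\ge1$ and every $\lambda>1$, $$\Bigl(1-\frac1\lambda\Bigr)\frac{1}{t_{\lambda\theta}}\;\le\;c_*(\theta V)\;\le\;\frac{1}{t_\theta}.$$ Consequently, if $\lim_{\theta\to\infty}t_{\lambda\theta}/t_\theta=1$ for every fixed $\lambda>1$ (the ratio being understood to be defined, with $0<t_\theta<\infty$, for large $\theta$), then $c_*(\theta V)\sim 1/t_\theta$ as $\theta\to\infty$, i.e. $c_*(\theta V)\,t_\theta\to1$.
   Context: Standing setting: $X$ is a centered, nondegenerate, infinitely divisible real random variable with variance $0<V=\mathrm{Var}(X)<\infty$, Gaussian variance $a\ge0$ and Lévy measure $\nu$ on $\mathbb{R}\setminus\{0\}$. For all real $t$, $K_X(t)=\log\mathbb{E}e^{tX}=\frac{at^2}{2}+\int_{\mathbb{R}\setminus\{0\}}(e^{tx}-1-tx)\,\nu(dx)\in[0,\infty]$, and $V=a+\int x^2\,\nu(dx)$. Let $H_X(dx)=a\delta_0(dx)+x^2\nu(dx)$ (total mass $V$), let $Z$ have law $H_X/V$, let $B\sim\mathrm{Beta}(1,2)$ (density $2(1-b)$ on $(0,1)$) be independent of $Z$, and put $R=BZ$, $M_R(t)=\mathbb{E}e^{tR}\in(0,\infty]$. Conventions: $1/0=\infty$, $1/\infty=0$, $\inf\emptyset=\infty$. A pair $(v,c)\in(0,\infty)\times[0,\infty)$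 is feasible for $X$ if $K_X(t)\le \frac{vt^2}{2(1-ct)}$ for every $0\le t<1/c$ (for $c=0$: for all $t\ge0$). $c_*(v)=\inf\{c\ge0:(v,c)\text{ is feasible}\}\in[0,\infty]$. *)

theory Defs
  imports "HOL-Probability.Probability"
begin

definition infinitely_divisible :: "real measure \<Rightarrow> bool" where
  "infinitely_divisible \<mu> \<longleftrightarrow>
     (\<forall>n::nat. n \<ge> 1 \<longrightarrow> (\<exists>\<rho>. real_distribution \<rho> \<and>
        \<mu> = distr (Pi\<^sub>M {..<n} (\<lambda>_. \<rho>)) borel (\<lambda>x. \<Sum>i<n. x i)))"

text \<open>A measure on the line without its origin is represented by a Borel measure on the whole
  line that does not charge the origin.\<close>

definition levy_measure :: "real measure \<Rightarrow> bool" where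
  "levy_measure \<nu> \<longleftrightarrow>
     sets \<nu> = sets borel \<and> emeasure \<nu> {0} = 0 \<and>
     (\<integral>\<^sup>+x. ennreal (min 1 (x\<^sup>2)) \<partial>\<nu>) < \<infinity>"

text \<open>The Levy-Khintchine representation with the truncation function \<open>x \<mapsto> x 1{|x| \<le> 1}\<close>.
  The drift \<open>b\<close> depends on the choice of truncation, the Gaussian variance \<open>a\<close> and the Levy
  measure \<open>\<nu>\<close> do not.\<close>

definition levy_triplet :: "real measure \<Rightarrow> real \<Rightarrow> real \<Rightarrow> real measure \<Rightarrow> bool" where
  "levy_triplet \<mu> b a \<nu> \<longleftrightarrow>
     0 \<le> a \<and> levy_measure \<nu> \<and>
     (\<forall>s. char \<mu> s = exp (\<i> * of_real (b * s) - of_real (a * s\<^sup>2 / 2)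
        + (CLINT x|\<nu>. iexp (s * x) - 1 - \<i> * of_real (s * x * indicator {-1..1} x))))"

definition mgf :: "'a measure \<Rightarrow> ('a \<Rightarrow> real) \<Rightarrow> real \<Rightarrow> ennreal" where
  "mgf M X t = (\<integral>\<^sup>+\<omega>. ennreal (exp (t * X \<omega>)) \<partial>M)"

text \<open>The logarithm of the moment generating function, with \<open>log \<infinity> = \<infinity>\<close>;
  the moment generating function of a random variable never vanishes.\<close>

definition cumulant :: "'a measure \<Rightarrow> ('a \<Rightarrow> real) \<Rightarrow> real \<Rightarrow> ereal" where
  "cumulant M X t = (if mgf M X t = \<infinity> then \<infinity> else ereal (ln (enn2real (mgf M X t))))"

text \<open>\<open>H(dx) = a \<delta>\<^sub>0(dx) + x\<^sup>2 \<nu>(dx)\<close>\<close>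

definition kolmogorov_measure :: "real \<Rightarrow> real measure \<Rightarrow> real measure" where
  "kolmogorov_measure a \<nu> = measure_of UNIV (sets borel)
     (\<lambda>A. ennreal a * indicator A 0 + (\<integral>\<^sup>+x\<in>A. ennreal (x\<^sup>2) \<partial>\<nu>))"

lemma sets_kolmogorov_measure [simp]: "sets (kolmogorov_measure a \<nu>) = sets borel"
  unfolding kolmogorov_measure_def
  using sets.sigma_sets_eq[of "borel :: real measure"] by simp

lemma emeasure_kolmogorov_measure:
  assumes "sets \<nu> = sets borel" "A \<in> sets borel"
  shows "emeasure (kolmogorov_measure a \<nu>) A =
    ennreal a * indicator A 0 + (\<integral>\<^sup>+x\<in>A. ennreal (x\<^sup>2) \<partial>\<nu>)"
proof -
  let ?m = "\<lambda>A. ennreal a * indicator A 0 + (\<integral>\<^sup>+x\<in>A. ennreal (x\<^sup>2) \<partial>\<nu>)"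
  let ?d = "density \<nu> (\<lambda>x. ennreal (x\<^sup>2))"
  let ?r = "scale_measure (ennreal a) (return borel (0::real))"
  have eq: "?m B = emeasure ?r B + emeasure ?d B" if "B \<in> sets borel" for B
    using that assms(1) by (simp add: emeasure_density measurable_cong_sets[OF assms(1) refl])
  have "emeasure (kolmogorov_measure a \<nu>) A = ?m A"
  proof (rule emeasure_measure_of[OF kolmogorov_measure_def])
    show "countably_additive (sets (kolmogorov_measure a \<nu>)) ?m"
    proof (rule countably_additiveI)
      fix F :: "nat \<Rightarrow> real set"
      assume F: "range F \<subseteq> sets (kolmogorov_measure a \<nu>)" "disjoint_family F"
        "(\<Union>i. F i) \<in> sets (kolmogorov_measure a \<nu>)"
      have "(\<Sum>i. ?m (F i)) = (\<Sum>i. emeasure ?r (F i) + emeasure ?d (F i))"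
        using F by (intro suminf_cong eq) auto
      also have "\<dots> = (\<Sum>i. emeasure ?r (F i)) + (\<Sum>i. emeasure ?d (F i))"
        by (rule suminf_add[symmetric]) auto
      also have "\<dots> = emeasure ?r (\<Union>i. F i) + emeasure ?d (\<Union>i. F i)"
        using F assms(1) by (intro arg_cong2[where f="(+)"] suminf_emeasure) auto
      also have "\<dots> = ?m (\<Union>i. F i)"
        using F by (intro eq[symmetric]) auto
      finally show "(\<Sum>i. ?m (F i)) = ?m (\<Union>i. F i)" .
    qed
  qed (use assms in \<open>auto simp: positive_def\<close>)
  then show ?thesis .
qed

text \<open>The condition \<open>c = 0 \<or> t < 1 / c\<close> is \<open>t < 1 / c\<close> under the convention \<open>1 / 0 = \<infinity>\<close>.\<close>

definition feasible :: "'a measure \<Rightarrow> ('a \<Rightarrow> real) \<Rightarrow> real \<Rightarrow> real \<Rightarrow> bool" where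
  "feasible M X v c \<longleftrightarrow> 0 < v \<and> 0 \<le> c \<and>
     (\<forall>t\<ge>0. (c = 0 \<or> t < 1 / c) \<longrightarrow> cumulant M X t \<le> ereal (v * t\<^sup>2 / (2 * (1 - c * t))))"

text \<open>In \<open>ennreal\<close> the infimum of the empty set is \<open>\<infinity>\<close>, and \<open>1 / 0 = \<infinity>\<close>, \<open>1 / \<infinity> = 0\<close>.\<close>

definition c_star :: "'a measure \<Rightarrow> ('a \<Rightarrow> real) \<Rightarrow> real \<Rightarrow> ennreal" where
  "c_star M X v = Inf {ennreal c |c. 0 \<le> c \<and> feasible M X v c}"

definition t_level :: "'b measure \<Rightarrow> ('b \<Rightarrow> real) \<Rightarrow> real \<Rightarrow> ennreal" where
  "t_level N R \<theta> = Inf {ennreal t |t. 0 < t \<and> mgf N R t > ennreal \<theta>}"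

end

theory Submission
  imports Defs
begin

text \<open>
  Let \<open>\<mu>\<close> be the law of \<open>X\<close>. The theorem rests on one formula: for \<open>t > 0\<close>, as an equation in
  \<open>[0,\<infinity>]\<close>, the cumulant of \<open>X\<close> is \<open>V t\<^sup>2 / 2\<close> times \<open>M\<^sub>R t = E exp (t B Z)\<close>
  (\<open>cumulant_eq_mgf_beta_multiple\<close>). Given this formula, \<open>(\<theta> V, c)\<close> is feasible if and only if
  \<open>M\<^sub>R t \<le> \<theta> / (1 - c t)\<close> for \<open>0 < t < 1 / c\<close>. The scale \<open>c = 1 / t\<^sub>\<theta>\<close> is feasible because
  \<open>M\<^sub>R \<le> \<theta>\<close> before \<open>t\<^sub>\<theta>\<close>; conversely, a feasible \<open>c\<close> forces \<open>M\<^sub>R \<le> \<lambda> \<theta>\<close> as long as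
  \<open>1 - c t \<ge> 1 / \<lambda>\<close>, so \<open>t\<^sub>\<lambda>\<^sub>\<theta> \<ge> (1 - 1 / \<lambda>) / c\<close> (\<open>c_star_le\<close>, \<open>c_star_ge\<close>). The asymptotic
  statement follows from these two bounds by letting \<open>\<lambda>\<close> tend to infinity after \<open>\<theta>\<close>.

  The Levy-Khintchine representation is given for the characteristic function only, and the
  formula for real exponents has to hold also where it reads \<open>\<infinity> = \<infinity>\<close>. The passage from imaginary to
  real exponents goes through an equality of laws. Let \<open>U\<close> be uniform on \<open>(0,1)\<close> and let \<open>W\<close> have
  the law \<open>x\<^sup>2 \<mu>(dx) / V\<close>. Differentiation of the Levy-Khintchine formula says that \<open>U W\<close> and the
  independent sum \<open>X + U Z\<close> have the same characteristic function, hence the same law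
  (\<open>uniform_multiple_square_biased_eq_convolution\<close>). Integrating exponentials against both laws
  gives, with \<open>M t = E exp (t X)\<close> and \<open>G t = E exp (t U Z)\<close>, the Volterra equation
  \<open>M t = 1 + \<integral> V s G s M s ds\<close> over \<open>(0,t)\<close>, in \<open>[0,\<infinity>]\<close>, whose finite solution is the
  exponential of \<open>\<kappa> t = \<integral> V s G s ds = V t\<^sup>2 / 2 M\<^sub>R t\<close>.

  Finiteness needs care on both sides. As \<open>M \<ge> 1\<close>, the equation shows that \<open>M t < \<infinity>\<close> implies
  \<open>\<kappa> t < \<infinity>\<close>. For the converse, testing the equality of laws with truncated exponentials turns
  the Volterra equation into an inequality for bounded functions, and Gronwall's inequality
  bounds these uniformly in the truncation (\<open>mgf_finite_if_mgf_step_finite\<close>). Left-continuity of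
  moment generating functions then settles the endpoint of the interval of finiteness.
\<close>

section \<open>Differentiation of complex-valued parameter integrals\<close>

text \<open>The bound \<open>w\<close> only has to dominate the derivative near \<open>s0\<close>: by the mean value inequality
it also dominates the difference quotients, and dominated convergence applies.\<close>

lemma has_vector_derivative_lebesgue_integral:
  fixes f f' :: "real \<Rightarrow> 'a \<Rightarrow> complex" and w :: "'a \<Rightarrow> real"
  assumes int: "\<And>s. integrable M (f s)"
    and meas [measurable]: "f' s0 \<in> borel_measurable M"
    and der: "\<And>s x. ((\<lambda>s. f s x) has_vector_derivative f' s x) (at s)"
    and w: "integrable M w"
    and bd: "\<And>s x. dist s0 s < 1 \<Longrightarrow> norm (f' s x) \<le> w x"
  shows "((\<lambda>s. \<integral>x. f s x \<partial>M) has_vector_derivative (\<integral>x. f' s0 x \<partial>M)) (at s0)"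
proof -
  define e where "e s x = ((f s x - f s0 x) - (s - s0) *\<^sub>R f' s0 x) /\<^sub>R norm (s - s0)" for s x
  have bd0: "norm (f' s0 x) \<le> w x" for x using bd[of s0 x] by simp
  have int': "integrable M (f' s0)"
    by (rule Bochner_Integration.integrable_bound[OF w]) (use bd0 in \<open>auto intro!: AE_I2 order_trans[OF bd0]\<close>)
  have lip: "norm (f s x - f s0 x) \<le> w x * norm (s - s0)" if "s \<in> ball s0 1" for s x
  proof (rule differentiable_bound[OF convex_ball _ _ that])
    fix r assume r: "r \<in> ball s0 1"
    show "((\<lambda>s. f s x) has_derivative (\<lambda>h. h *\<^sub>R f' r x)) (at r within ball s0 1)"
      using der[of x r] by (auto simp: has_vector_derivative_def intro: has_derivative_at_withinI)
    show "onorm (\<lambda>h. h *\<^sub>R f' r x) \<le> w x"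
      using bd[of r x] r by (intro onorm_bound) (auto simp: mult.commute intro: mult_left_mono order_trans[OF norm_ge_zero])
  qed simp
  have e_bd: "norm (e s x) \<le> 2 * w x" if "s \<in> ball s0 1" "s \<noteq> s0" for s x
  proof -
    have "norm ((f s x - f s0 x) - (s - s0) *\<^sub>R f' s0 x) \<le> norm (f s x - f s0 x) + norm ((s - s0) *\<^sub>R f' s0 x)"
      by (rule norm_triangle_ineq4)
    also have "\<dots> \<le> w x * norm (s - s0) + norm (s - s0) * w x"
      by (intro add_mono lip that) (auto intro!: mult_left_mono bd0)
    finally have "norm ((f s x - f s0 x) - (s - s0) *\<^sub>R f' s0 x) \<le> (2 * w x) * norm (s - s0)" by simp
    moreover have "norm (e s x) = norm ((f s x - f s0 x) - (s - s0) *\<^sub>R f' s0 x) / norm (s - s0)"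
      by (simp add: e_def divide_inverse mult.commute)
    ultimately show ?thesis using that(2) by (simp add: pos_divide_le_eq)
  qed
  have "((\<lambda>s. \<integral>x. e s x \<partial>M) \<longlongrightarrow> 0) (at s0 within ball s0 1)"
    unfolding tendsto_at_iff_sequentially comp_def
  proof safe
    fix Y assume Y: "\<forall>i. Y i \<in> ball s0 1 - {s0}" "Y \<longlonglongrightarrow> s0"
    have "(\<lambda>i. \<integral>x. e (Y i) x \<partial>M) \<longlonglongrightarrow> (\<integral>x. 0 \<partial>M)"
    proof (rule integral_dominated_convergence[where w="\<lambda>x. 2 * w x"])
      show "e (Y i) \<in> borel_measurable M" for i
        unfolding e_def using int[THEN borel_measurable_integrable] by measurable
      show "integrable M (\<lambda>x. 2 * w x)" using w by simp
      show "AE x in M. norm (e (Y i) x) \<le> 2 * w x" for i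
        using Y e_bd by auto
      show "AE x in M. (\<lambda>i. e (Y i) x) \<longlonglongrightarrow> 0"
      proof (rule AE_I2)
        fix x
        have "((\<lambda>s. e s x) \<longlongrightarrow> 0) (at s0)"
          using der[of x s0] unfolding has_vector_derivative_def has_derivative_at_within e_def by simp
        then show "(\<lambda>i. e (Y i) x) \<longlonglongrightarrow> 0"
          using Y by (auto simp: tendsto_at_iff_sequentially comp_def)
      qed
    qed simp
    then show "(\<lambda>i. \<integral>x. e (Y i) x \<partial>M) \<longlonglongrightarrow> 0" by simp
  qed
  then have "((\<lambda>s. (((\<integral>x. f s x \<partial>M) - (\<integral>x. f s0 x \<partial>M)) - (s - s0) *\<^sub>R (\<integral>x. f' s0 x \<partial>M)) /\<^sub>R norm (s - s0)) \<longlongrightarrow> 0) (at s0 within ball s0 1)"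
    by (simp add: e_def int int')
  then have "((\<lambda>s. \<integral>x. f s x \<partial>M) has_vector_derivative (\<integral>x. f' s0 x \<partial>M)) (at s0 within ball s0 1)"
    unfolding has_vector_derivative_def has_derivative_at_within
    by (auto intro: bounded_linear_scaleR_left)
  then show ?thesis
    by (simp add: at_within_open[of s0 "ball s0 1"])
qed

section \<open>Uniform multiples of a law\<close>

definition unif :: "real measure" where
  "unif = density lborel (indicator {0..1})"

definition uniform_multiple :: "real measure \<Rightarrow> real measure" where
  "uniform_multiple \<pi> = distr (\<pi> \<Otimes>\<^sub>M unif) borel (\<lambda>(z, u). u * z)"

lemma sets_unif [simp, measurable_cong]: "sets unif = sets borel"
  by (simp add: unif_def)

lemma space_unif [simp]: "space unif = UNIV"
  by (simp add: unif_def)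

interpretation unif: real_distribution unif
proof -
  interpret prob_space unif
    by (rule prob_spaceI) (simp add: unif_def emeasure_density)
  show "real_distribution unif" by unfold_locales simp_all
qed

lemma real_distribution_uniform_multiple:
  assumes "real_distribution \<pi>"
  shows "real_distribution (uniform_multiple \<pi>)"
proof -
  interpret \<pi>: real_distribution \<pi> by fact
  interpret pair_prob_space \<pi> unif ..
  show ?thesis
    unfolding uniform_multiple_def
    by (intro real_distribution_distr) simp
qed

lemma nn_integral_unif:
  assumes [measurable]: "f \<in> borel_measurable borel"
  shows "(\<integral>\<^sup>+u. f u \<partial>unif) = (\<integral>\<^sup>+u. f u * indicator {0..1} u \<partial>lborel)"
  by (simp add: unif_def nn_integral_density mult.commute)

lemma nn_integral_uniform_multiple:
  assumes "real_distribution \<pi>" and [measurable]: "f \<in> borel_measurable borel"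
  shows "(\<integral>\<^sup>+y. f y \<partial>uniform_multiple \<pi>) = (\<integral>\<^sup>+z. \<integral>\<^sup>+u. f (u * z) \<partial>unif \<partial>\<pi>)"
proof -
  interpret \<pi>: real_distribution \<pi> by fact
  show ?thesis
    unfolding uniform_multiple_def
    by (subst nn_integral_distr) (auto simp: unif.nn_integral_fst[symmetric])
qed

lemma char_uniform_multiple:
  assumes "real_distribution \<pi>"
  shows "char (uniform_multiple \<pi>) s = (\<integral>z. char unif (s * z) \<partial>\<pi>)"
proof -
  interpret \<pi>: real_distribution \<pi> by fact
  interpret pair_prob_space \<pi> unif ..
  have "char (uniform_multiple \<pi>) s = (\<integral>p. iexp (s * (snd p * fst p)) \<partial>(\<pi> \<Otimes>\<^sub>M unif))"
    unfolding uniform_multiple_def char_def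
    by (subst integral_distr) (auto simp: case_prod_beta')
  also have "\<dots> = (\<integral>z. \<integral>u. iexp (s * (u * z)) \<partial>unif \<partial>\<pi>)"
  proof (subst integral_fst'[symmetric])
    show "integrable (\<pi> \<Otimes>\<^sub>M unif) (\<lambda>p. iexp (s * (snd p * fst p)))"
      by (rule integrable_iexp) auto
  qed simp
  finally show ?thesis
    by (simp add: char_def mult_ac)
qed

text \<open>Written without a division so that it also covers \<open>y = 0\<close>.\<close>

lemma char_unif: "\<i> * of_real y * char unif y = iexp y - 1"
proof -
  have "char unif y = (\<integral>u. indicator {0..1} u *\<^sub>R iexp (y * u) \<partial>lborel)"
    unfolding char_def unif_def
    by (subst integral_density[of _ _ "indicator {0..1}", simplified ennreal_indicator]) auto
  then have "\<i> * of_real y * char unif y = (\<integral>u. \<i> * of_real y * (indicator {0..1} u *\<^sub>R iexp (y * u)) \<partial>lborel)"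
    by (simp only: integral_mult_right_zero)
  also have "\<dots> = (\<integral>u. indicator {0..1} u *\<^sub>R (\<i> * of_real y * iexp (y * u)) \<partial>lborel)"
    by (intro Bochner_Integration.integral_cong) (auto simp: indicator_def)
  also have "\<dots> = iexp (y * 1) - iexp (y * 0)"
  proof (rule integral_FTC_Icc)
    fix u :: real
    show "((\<lambda>u. iexp (y * u)) has_vector_derivative \<i> * of_real y * iexp (y * u)) (at u within {0..1})"
      by (auto intro!: derivative_eq_intros simp: Re_exp Im_exp has_vector_derivative_complex_iff)
  qed (auto intro!: continuous_intros)
  finally show ?thesis by simp
qed


lemma measurable_char_unif [measurable]: "char unif \<in> borel_measurable borel"
  by (rule unif.char_measurable)

lemma cmod_char_unif: "cmod (char unif y) \<le> 1"
  by (rule unif.cmod_char_le_1)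

section \<open>The zero-bias identity from the Levy-Khintchine formula\<close>

lemma has_vector_derivative_iexp_mult:
  "((\<lambda>s. iexp (s * x)) has_vector_derivative \<i> * of_real x * iexp (s * x)) (at s)"
  by (auto intro!: derivative_eq_intros simp: Re_exp Im_exp has_vector_derivative_complex_iff)

lemma cmod_iexp_minus_1: "cmod (iexp y - 1) \<le> \<bar>y\<bar>"
  using iexp_approx1[of y 0] by simp

lemma cmod_iexp_minus_1_minus: "cmod (iexp y - 1 - \<i> * of_real y) \<le> y\<^sup>2 / 2"
  using iexp_approx1[of y 1] by (simp add: diff_diff_eq numeral_2_eq_2)

lemma emeasure_kolmogorov_law:
  assumes "sets \<nu> = sets borel" "\<pi> = scale_measure (ennreal (1 / V)) (kolmogorov_measure a \<nu>)"
    "A \<in> sets borel"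
  shows "emeasure \<pi> A = ennreal (1 / V) * (ennreal a * indicator A 0 + (\<integral>\<^sup>+x\<in>A. ennreal (x\<^sup>2) \<partial>\<nu>))"
  using assms by (simp add: emeasure_kolmogorov_measure)

lemma integrable_square_levy:
  assumes "sets \<nu> = sets borel" "\<pi> = scale_measure (ennreal (1 / V)) (kolmogorov_measure a \<nu>)"
    "prob_space \<pi>" "0 < V"
  shows "integrable \<nu> (\<lambda>x. x\<^sup>2)"
proof -
  interpret prob_space \<pi> by fact
  note [measurable_cong] = assms(1)
  have "space \<pi> = UNIV" using assms(2) sets_eq_imp_space_eq[of \<pi> borel] by simp
  then have "1 = ennreal (1 / V) * (ennreal a + (\<integral>\<^sup>+x. ennreal (x\<^sup>2) \<partial>\<nu>))"
    using emeasure_space_1 emeasure_kolmogorov_law[OF assms(1,2), of UNIV] by simp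
  then have "(\<integral>\<^sup>+x. ennreal (x\<^sup>2) \<partial>\<nu>) < \<infinity>"
    using \<open>0 < V\<close> by (auto simp: less_top[symmetric] ennreal_mult_top ennreal_top_mult)
  then show ?thesis
    by (intro integrableI_nonneg) auto
qed

text \<open>The law \<open>H / V\<close> has an atom \<open>a / V\<close> at the origin, and away from the origin it is the measure
with density \<open>x\<^sup>2 / V\<close> with respect to \<open>\<nu>\<close>; the integral is split accordingly.\<close>

lemma integral_kolmogorov_law:
  fixes f :: "real \<Rightarrow> complex"
  assumes \<nu>: "sets \<nu> = sets borel" "emeasure \<nu> {0} = 0"
    and \<pi>: "\<pi> = scale_measure (ennreal (1 / V)) (kolmogorov_measure a \<nu>)" "real_distribution \<pi>"
    and V: "0 < V" "0 \<le> a"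
    and f [measurable]: "f \<in> borel_measurable borel" and bd: "\<And>x. cmod (f x) \<le> C"
  shows "of_real V * (\<integral>x. f x \<partial>\<pi>) = of_real a * f 0 + (\<integral>x. x\<^sup>2 *\<^sub>R f x \<partial>\<nu>)"
proof -
  interpret \<pi>: real_distribution \<pi> by fact
  note [measurable_cong] = \<nu>(1)
  have em: "emeasure \<pi> A = ennreal (1 / V) * (ennreal a * indicator A 0 + (\<integral>\<^sup>+x\<in>A. ennreal (x\<^sup>2) \<partial>\<nu>))"
    if "A \<in> sets borel" for A
    by (rule emeasure_kolmogorov_law[OF \<nu>(1) \<pi>(1) that])
  have int: "integrable \<pi> f" by (rule \<pi>.integrable_const_bound[of _ C]) (use bd in auto)
  have "(\<integral>\<^sup>+x\<in>{0}. ennreal (x\<^sup>2) \<partial>\<nu>) = (\<integral>\<^sup>+x. 0 \<partial>\<nu>)"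
    by (intro nn_integral_cong) (auto simp: indicator_def)
  then have atom: "emeasure \<pi> {0} = ennreal (a / V)"
    using V by (subst em) (auto simp: ennreal_mult'[symmetric] divide_inverse mult.commute)
  have dens: "density \<pi> (\<lambda>x. ennreal (V * indicator (-{0}) x)) = density \<nu> (\<lambda>x. ennreal (x\<^sup>2))"
  proof (rule measure_eqI)
    fix A assume "A \<in> sets (density \<pi> (\<lambda>x. ennreal (V * indicator (-{0}) x)))"
    then have [measurable]: "A \<in> sets borel" by simp
    have "emeasure (density \<pi> (\<lambda>x. ennreal (V * indicator (-{0}) x))) A
        = (\<integral>\<^sup>+x. ennreal V * indicator (A - {0}) x \<partial>\<pi>)"
      by (subst emeasure_density) (auto intro!: nn_integral_cong simp: indicator_def)
    also have "\<dots> = ennreal V * emeasure \<pi> (A - {0})" by (subst nn_integral_cmult_indicator) auto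
    also have "\<dots> = ennreal V * (ennreal (1 / V) * (\<integral>\<^sup>+x\<in>A-{0}. ennreal (x\<^sup>2) \<partial>\<nu>))"
      by (subst em) auto
    also have "\<dots> = (\<integral>\<^sup>+x\<in>A-{0}. ennreal (x\<^sup>2) \<partial>\<nu>)"
      using V by (simp add: mult.assoc[symmetric] ennreal_mult[symmetric])
    also have "\<dots> = emeasure (density \<nu> (\<lambda>x. ennreal (x\<^sup>2))) A"
      by (subst emeasure_density) (auto intro!: nn_integral_cong simp: indicator_def)
    finally show "emeasure (density \<pi> (\<lambda>x. ennreal (V * indicator (-{0}) x))) A
      = emeasure (density \<nu> (\<lambda>x. ennreal (x\<^sup>2))) A" .
  qed (simp add: \<nu>)
  have "of_real V * (\<integral>x. f x \<partial>\<pi>) = (\<integral>x. of_real V * f x \<partial>\<pi>)" by simp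
  also have "\<dots> = (\<integral>x. indicator {0} x *\<^sub>R (of_real V * f 0) + (V * indicator (-{0}) x) *\<^sub>R f x \<partial>\<pi>)"
    by (intro Bochner_Integration.integral_cong) (auto simp: indicator_def scaleR_conv_of_real)
  also have "\<dots> = (\<integral>x. indicator {0} x *\<^sub>R (of_real V * f 0) \<partial>\<pi>) + (\<integral>x. (V * indicator (-{0}) x) *\<^sub>R f x \<partial>\<pi>)"
  proof (rule Bochner_Integration.integral_add)
    show "integrable \<pi> (\<lambda>x. (V * indicator (-{0}) x) *\<^sub>R f x)"
      by (rule Bochner_Integration.integrable_bound[OF integrable_scaleR_right[OF int, of V]])
        (auto simp: indicator_def)
    show "integrable \<pi> (\<lambda>x. indicator {0} x *\<^sub>R (of_real V * f 0))"
      by (rule integrable_indicator) (auto simp: atom)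
  qed
  also have "(\<integral>x. indicator {0} x *\<^sub>R (of_real V * f 0) \<partial>\<pi>) = of_real a * f 0"
    using V atom by (simp add: measure_def scaleR_conv_of_real)
  also have "(\<integral>x. (V * indicator (-{0}) x) *\<^sub>R f x \<partial>\<pi>) = integral\<^sup>L (density \<pi> (\<lambda>x. ennreal (V * indicator (-{0}) x))) f"
    using V by (subst integral_density) auto
  also have "\<dots> = (\<integral>x. x\<^sup>2 *\<^sub>R f x \<partial>\<nu>)"
    unfolding dens by (subst integral_density) auto
  finally show ?thesis .
qed

text \<open>Multiplication by \<open>\<i> s\<close> turns \<open>x\<^sup>2\<close> times the characteristic function of \<open>U\<close> at \<open>s x\<close> into
\<open>x (exp (\<i> s x) - 1)\<close>. The right-hand side is thus, up to the factor \<open>\<i>\<close>, the derivative of the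
Levy-Khintchine exponent of a centered law.\<close>

lemma char_uniform_multiple_kolmogorov:
  assumes \<nu>: "sets \<nu> = sets borel" "emeasure \<nu> {0} = 0"
    and \<pi>: "\<pi> = scale_measure (ennreal (1 / V)) (kolmogorov_measure a \<nu>)" "real_distribution \<pi>"
    and V: "0 < V" "0 \<le> a"
  shows "\<i> * of_real (s * V) * char (uniform_multiple \<pi>) s =
    \<i> * of_real (a * s) + (\<integral>x. of_real x * (iexp (s * x) - 1) \<partial>\<nu>)"
proof -
  have "of_real V * char (uniform_multiple \<pi>) s = of_real a * char unif (s * 0) + (\<integral>x. x\<^sup>2 *\<^sub>R char unif (s * x) \<partial>\<nu>)"
    unfolding char_uniform_multiple[OF \<pi>(2)]
    by (rule integral_kolmogorov_law[OF \<nu> \<pi> V, where C=1]) (auto intro: cmod_char_unif)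
  then have "\<i> * of_real s * (of_real V * char (uniform_multiple \<pi>) s) =
     \<i> * of_real s * (of_real a + (\<integral>x. x\<^sup>2 *\<^sub>R char unif (s * x) \<partial>\<nu>))"
    by (simp add: unif.char_zero)
  then have "\<i> * of_real (s * V) * char (uniform_multiple \<pi>) s =
     \<i> * of_real (a * s) + \<i> * of_real s * (\<integral>x. x\<^sup>2 *\<^sub>R char unif (s * x) \<partial>\<nu>)"
    by (simp only: distrib_left of_real_mult mult_ac)
  also have "\<i> * of_real s * (\<integral>x. x\<^sup>2 *\<^sub>R char unif (s * x) \<partial>\<nu>)
      = (\<integral>x. \<i> * of_real s * x\<^sup>2 *\<^sub>R char unif (s * x) \<partial>\<nu>)"
    by (simp only: integral_mult_right_zero)
  also have "\<dots> = (\<integral>x. of_real x * (\<i> * of_real (s * x) * char unif (s * x)) \<partial>\<nu>)"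
    by (simp add: scaleR_conv_of_real power2_eq_square mult_ac)
  also have "\<dots> = (\<integral>x. of_real x * (iexp (s * x) - 1) \<partial>\<nu>)"
    unfolding char_unif ..
  finally show ?thesis .
qed

lemma has_vector_derivative_levy_exponent:
  assumes \<nu> [measurable_cong]: "sets \<nu> = sets borel" and sq: "integrable \<nu> (\<lambda>x. x\<^sup>2)"
  shows "((\<lambda>s. \<integral>x. iexp (s * x) - 1 - \<i> * of_real (s * x) \<partial>\<nu>) has_vector_derivative
    (\<integral>x. \<i> * (of_real x * (iexp (s0 * x) - 1)) \<partial>\<nu>)) (at s0)"
proof (rule has_vector_derivative_lebesgue_integral[where f = "\<lambda>s x. iexp (s * x) - 1 - \<i> * of_real (s * x)"
      and f' = "\<lambda>s x. \<i> * (of_real x * (iexp (s * x) - 1))"])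
  show "integrable \<nu> (\<lambda>x. iexp (s * x) - 1 - \<i> * of_real (s * x))" for s
  proof (rule Bochner_Integration.integrable_bound)
    show "integrable \<nu> (\<lambda>x. s\<^sup>2 / 2 * x\<^sup>2)" using sq by simp
    show "AE x in \<nu>. norm (iexp (s * x) - 1 - \<i> * of_real (s * x)) \<le> norm (s\<^sup>2 / 2 * x\<^sup>2)"
      using cmod_iexp_minus_1_minus[of "s * x" for x] by (auto simp: power_mult_distrib)
  qed simp
  show "integrable \<nu> (\<lambda>x. (\<bar>s0\<bar> + 1) * x\<^sup>2)" using sq by simp
  show "cmod (\<i> * (of_real x * (iexp (s * x) - 1))) \<le> (\<bar>s0\<bar> + 1) * x\<^sup>2" if "dist s0 s < 1" for s x
  proof -
    have "cmod (\<i> * (of_real x * (iexp (s * x) - 1))) = \<bar>x\<bar> * cmod (iexp (s * x) - 1)"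
      by (simp add: norm_mult)
    also have "\<dots> \<le> \<bar>x\<bar> * \<bar>s * x\<bar>" by (intro mult_left_mono cmod_iexp_minus_1) simp
    also have "\<dots> = \<bar>s\<bar> * x\<^sup>2" by (simp add: abs_mult power2_eq_square)
    also have "\<dots> \<le> (\<bar>s0\<bar> + 1) * x\<^sup>2"
      using that by (intro mult_right_mono) (auto simp: dist_real_def)
    finally show ?thesis .
  qed
  show "((\<lambda>s. iexp (s * x) - 1 - \<i> * of_real (s * x)) has_vector_derivative
      \<i> * (of_real x * (iexp (s * x) - 1))) (at s)" for s x
    by (auto intro!: derivative_eq_intros simp: Re_exp Im_exp has_vector_derivative_complex_iff algebra_simps)
qed simp

text \<open>Since \<open>\<nu>\<close> integrates \<open>x\<^sup>2\<close>, the large jumps are integrable and can be compensated as well; this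
only changes the drift.\<close>

lemma levy_triplet_compensated:
  assumes LK: "levy_triplet \<mu> b a \<nu>" and sq: "integrable \<nu> (\<lambda>x. x\<^sup>2)"
  obtains b' where "\<And>s. char \<mu> s = exp (\<i> * of_real (b' * s) - of_real (a * s\<^sup>2 / 2)
        + (\<integral>x. iexp (s * x) - 1 - \<i> * of_real (s * x) \<partial>\<nu>))"
proof 
  fix s
  have \<nu> [measurable_cong]: "sets \<nu> = sets borel" using LK by (simp add: levy_triplet_def levy_measure_def)
  define c where "c x = x - x * indicator {-1..1} x" for x :: real
  have [measurable]: "c \<in> borel_measurable borel" unfolding c_def by measurable
  have c: "integrable \<nu> c"
  proof (rule Bochner_Integration.integrable_bound[OF sq])
    have "\<bar>c x\<bar> \<le> x\<^sup>2" for x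
    proof (cases "\<bar>x\<bar> \<le> 1")
      case False
      then have "\<bar>x\<bar> * 1 \<le> \<bar>x\<bar> * \<bar>x\<bar>" by (intro mult_left_mono) auto
      moreover have "c x = x" using False by (auto simp: c_def indicator_def)
      ultimately show ?thesis by (simp add: power2_eq_square)
    qed (auto simp: c_def indicator_def)
    then show "AE x in \<nu>. norm (c x) \<le> norm (x\<^sup>2)" by auto
  qed simp
  have int: "integrable \<nu> (\<lambda>x. iexp (s * x) - 1 - \<i> * of_real (s * x))"
  proof (rule Bochner_Integration.integrable_bound)
    show "integrable \<nu> (\<lambda>x. s\<^sup>2 / 2 * x\<^sup>2)" using sq by simp
    show "AE x in \<nu>. norm (iexp (s * x) - 1 - \<i> * of_real (s * x)) \<le> norm (s\<^sup>2 / 2 * x\<^sup>2)"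
      using cmod_iexp_minus_1_minus[of "s * x" for x] by (auto simp: power_mult_distrib)
  qed simp
  have c': "integrable \<nu> (\<lambda>x. \<i> * of_real s * of_real (c x))" using c by simp
  have "(\<integral>x. iexp (s * x) - 1 - \<i> * of_real (s * x * indicator {-1..1} x) \<partial>\<nu>) =
      (\<integral>x. (iexp (s * x) - 1 - \<i> * of_real (s * x)) + \<i> * of_real s * of_real (c x) \<partial>\<nu>)"
    by (intro Bochner_Integration.integral_cong) (auto simp: c_def algebra_simps)
  also have "\<dots> = (\<integral>x. iexp (s * x) - 1 - \<i> * of_real (s * x) \<partial>\<nu>) + \<i> * of_real s * of_real (\<integral>x. c x \<partial>\<nu>)"
    by (subst Bochner_Integration.integral_add[OF int c']) simp
  finally show "char \<mu> s = exp (\<i> * of_real ((b + (\<integral>x. c x \<partial>\<nu>)) * s) - of_real (a * s\<^sup>2 / 2)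
        + (\<integral>x. iexp (s * x) - 1 - \<i> * of_real (s * x) \<partial>\<nu>))"
    using LK by (simp add: levy_triplet_def algebra_simps)
qed

text \<open>If \<open>\<mu>\<close> is centered with variance \<open>V\<close>, then the uniform multiple of this law is the
zero-biased law of \<open>\<mu>\<close> from Stein's method.\<close>

definition square_biased :: "real \<Rightarrow> real measure \<Rightarrow> real measure" where
  "square_biased V \<mu> = density \<mu> (\<lambda>x. ennreal (x\<^sup>2 / V))"

lemma real_distribution_square_biased:
  assumes "real_distribution \<mu>" "integrable \<mu> (\<lambda>x. x\<^sup>2)" "(\<integral>x. x\<^sup>2 \<partial>\<mu>) = V" "0 < V"
  shows "real_distribution (square_biased V \<mu>)"
proof -
  interpret real_distribution \<mu> by fact
  have "(\<integral>\<^sup>+x. ennreal (x\<^sup>2 / V) \<partial>\<mu>) = ennreal (\<integral>x. x\<^sup>2 / V \<partial>\<mu>)"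
    using assms by (intro nn_integral_eq_integral) auto
  also have "\<dots> = 1" using assms by simp
  finally have "prob_space (square_biased V \<mu>)"
    by (intro prob_spaceI) (simp add: square_biased_def emeasure_density)
  then show ?thesis
    by (simp add: real_distribution_def real_distribution_axioms_def square_biased_def)
qed

text \<open>The right-hand side is \<open>-\<i>\<close> times the derivative of the characteristic function of \<open>\<mu>\<close>.
Centering removes the term \<open>\<integral>x d\<mu>\<close> left over by \<open>char_unif\<close>.\<close>

lemma char_uniform_multiple_square_biased:
  assumes \<mu>: "real_distribution \<mu>" "integrable \<mu> (\<lambda>x. x\<^sup>2)" "(\<integral>x. x\<^sup>2 \<partial>\<mu>) = V" "0 < V"
    and mean: "integrable \<mu> (\<lambda>x. x)" "(\<integral>x. x \<partial>\<mu>) = 0"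
  shows "\<i> * of_real (s * V) * char (uniform_multiple (square_biased V \<mu>)) s =
    (\<integral>x. of_real x * iexp (s * x) \<partial>\<mu>)"
proof -
  interpret real_distribution \<mu> by fact
  have "\<i> * of_real (s * V) * char (uniform_multiple (square_biased V \<mu>)) s
    = \<i> * of_real (s * V) * (\<integral>x. (x\<^sup>2 / V) *\<^sub>R char unif (s * x) \<partial>\<mu>)"
    using \<mu>(4) unfolding char_uniform_multiple[OF real_distribution_square_biased[OF \<mu>]]
    unfolding square_biased_def by (subst integral_density) auto
  also have "\<dots> = (\<integral>x. \<i> * of_real (s * V) * (x\<^sup>2 / V) *\<^sub>R char unif (s * x) \<partial>\<mu>)"
    by (simp only: integral_mult_right_zero)
  also have "\<dots> = (\<integral>x. of_real x * (\<i> * of_real (s * x) * char unif (s * x)) \<partial>\<mu>)"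
    using \<mu>(4) by (intro Bochner_Integration.integral_cong)
      (auto simp: scaleR_conv_of_real power2_eq_square field_simps)
  also have "\<dots> = (\<integral>x. of_real x * iexp (s * x) - of_real x \<partial>\<mu>)"
    unfolding char_unif by (simp add: algebra_simps)
  also have "\<dots> = (\<integral>x. of_real x * iexp (s * x) \<partial>\<mu>) - (\<integral>x. of_real x \<partial>\<mu>)"
  proof (rule Bochner_Integration.integral_diff)
    show "integrable \<mu> (\<lambda>x. of_real x * iexp (s * x))"
      by (rule Bochner_Integration.integrable_bound[OF mean(1)]) (auto simp: norm_mult)
  qed (use mean in simp)
  finally show ?thesis using mean by simp
qed

text \<open>Let \<open>X\<close> have law \<open>\<mu>\<close>, \<open>W\<close> the square-biased law, and \<open>Z\<close> the law \<open>\<pi>\<close>. The logarithmic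
derivative of the characteristic function \<open>\<phi>\<close> of \<open>X\<close> is computed twice. Directly it is
\<open>- s V E exp (\<i> s U W) / \<phi> s\<close>; from the Levy-Khintchine exponent it is
\<open>\<i> b' - s V E exp (\<i> s U Z)\<close>, and evaluation at \<open>s = 0\<close> gives \<open>b' = 0\<close> because \<open>X\<close> is centered.
So \<open>U W\<close> and the independent sum \<open>X + U Z\<close> have the same characteristic function, hence the
same law. Unlike the Levy-Khintchine formula itself, an equality of laws can be integrated
against exponentials, whether or not the integrals are finite.\<close>

lemma uniform_multiple_square_biased_eq_convolution:
  assumes \<mu>: "real_distribution \<mu>" "integrable \<mu> (\<lambda>x. x\<^sup>2)" "(\<integral>x. x\<^sup>2 \<partial>\<mu>) = V" "0 < V"
    and mean: "integrable \<mu> (\<lambda>x. x)" "(\<integral>x. x \<partial>\<mu>) = 0"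
    and LK: "levy_triplet \<mu> b a \<nu>"
    and \<pi>: "\<pi> = scale_measure (ennreal (1 / V)) (kolmogorov_measure a \<nu>)" "real_distribution \<pi>"
  shows "uniform_multiple (square_biased V \<mu>) =
    distr (\<mu> \<Otimes>\<^sub>M uniform_multiple \<pi>) borel (\<lambda>(x, y). x + y)"
proof -
  interpret \<mu>: real_distribution \<mu> by fact
  interpret W: real_distribution "uniform_multiple (square_biased V \<mu>)"
    by (intro real_distribution_uniform_multiple real_distribution_square_biased \<mu>)
  interpret U: real_distribution "uniform_multiple \<pi>"
    by (intro real_distribution_uniform_multiple \<pi>)
  interpret P: pair_prob_space \<mu> "uniform_multiple \<pi>" ..
  have \<nu>: "sets \<nu> = sets borel" "emeasure \<nu> {0} = 0" and a: "0 \<le> a"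
    using LK by (simp_all add: levy_triplet_def levy_measure_def)
  have sq: "integrable \<nu> (\<lambda>x. x\<^sup>2)"
    using integrable_square_levy[OF \<nu>(1) \<pi>(1) _ \<mu>(4)] \<pi>(2) by (simp add: real_distribution_def)
  obtain b' where b': "\<And>s. char \<mu> s = exp (\<i> * of_real (b' * s) - of_real (a * s\<^sup>2 / 2)
        + (\<integral>x. iexp (s * x) - 1 - \<i> * of_real (s * x) \<partial>\<nu>))"
    using levy_triplet_compensated[OF LK sq] by blast
  define \<eta> where "\<eta> s = \<i> * of_real (b' * s) - of_real (a * s\<^sup>2 / 2)
        + (\<integral>x. iexp (s * x) - 1 - \<i> * of_real (s * x) \<partial>\<nu>)" for s
  have char_\<mu>: "char \<mu> = exp \<circ> \<eta>" using b' by (auto simp: \<eta>_def)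
  let ?W = "char (uniform_multiple (square_biased V \<mu>))" and ?U = "char (uniform_multiple \<pi>)"
  have "(\<eta> has_vector_derivative (\<i> * of_real b' - of_real (a * s) + (\<integral>x. \<i> * (of_real x * (iexp (s * x) - 1)) \<partial>\<nu>))) (at s)" for s
    unfolding \<eta>_def[abs_def]
    apply (intro derivative_intros has_vector_derivative_levy_exponent \<nu> sq)
    by (auto intro!: derivative_eq_intros simp: has_vector_derivative_complex_iff)
  moreover have "\<i> * of_real b' - of_real (a * s) + (\<integral>x. \<i> * (of_real x * (iexp (s * x) - 1)) \<partial>\<nu>)
      = \<i> * of_real b' - of_real (s * V) * ?U s" for s
  proof -
    have "(\<integral>x. \<i> * (of_real x * (iexp (s * x) - 1)) \<partial>\<nu>) = \<i> * (\<integral>x. of_real x * (iexp (s * x) - 1) \<partial>\<nu>)"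
      by (simp only: integral_mult_right_zero)
    also have "\<dots> = \<i> * (\<i> * of_real (s * V) * ?U s - \<i> * of_real (a * s))"
      unfolding char_uniform_multiple_kolmogorov[OF \<nu> \<pi> \<mu>(4) a] by simp
    finally show ?thesis by (simp add: algebra_simps)
  qed
  ultimately have d\<eta>: "(\<eta> has_vector_derivative (\<i> * of_real b' - of_real (s * V) * ?U s)) (at s)" for s
    by (simp only:)
  have "(char \<mu> has_vector_derivative ((\<i> * of_real b' - of_real (s * V) * ?U s) * exp (\<eta> s))) (at s)" for s
    unfolding char_\<mu> by (rule field_vector_diff_chain_at[OF d\<eta>]) (auto intro!: derivative_eq_intros)
  then have d1: "(char \<mu> has_vector_derivative ((\<i> * of_real b' - of_real (s * V) * ?U s) * char \<mu> s)) (at s)" for s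
    by (simp add: char_\<mu>)
  have "((\<lambda>s. \<integral>x. iexp (s * x) \<partial>\<mu>) has_vector_derivative (\<integral>x. \<i> * of_real x * iexp (s * x) \<partial>\<mu>)) (at s)" for s
  proof (rule has_vector_derivative_lebesgue_integral[where f="\<lambda>s x. iexp (s * x)" and w="\<lambda>x. \<bar>x\<bar>"
      and f'="\<lambda>s x. \<i> * of_real x * iexp (s * x)"])
    show "((\<lambda>s. iexp (s * x)) has_vector_derivative \<i> * of_real x * iexp (s * x)) (at s)" for s x
      by (rule has_vector_derivative_iexp_mult)
  qed (auto intro!: \<mu>.integrable_iexp integrable_abs mean(1) simp: norm_mult)
  moreover have "(\<integral>x. \<i> * of_real x * iexp (s * x) \<partial>\<mu>) = - of_real (s * V) * ?W s" for s
  proof -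
    have "(\<integral>x. \<i> * of_real x * iexp (s * x) \<partial>\<mu>) = \<i> * (\<integral>x. of_real x * iexp (s * x) \<partial>\<mu>)"
      by (simp only: integral_mult_right_zero mult.assoc)
    also have "\<dots> = \<i> * (\<i> * of_real (s * V) * ?W s)"
      unfolding char_uniform_multiple_square_biased[OF \<mu> mean] ..
    also have "\<dots> = - of_real (s * V) * ?W s" by (simp add: mult.assoc[symmetric])
    finally show ?thesis .
  qed
  ultimately have d2: "(char \<mu> has_vector_derivative - of_real (s * V) * ?W s) (at s)" for s
    by (simp add: char_def[abs_def])
  have eq: "(\<i> * of_real b' - of_real (s * V) * ?U s) * char \<mu> s = - of_real (s * V) * ?W s" for s
    by (rule vector_derivative_unique_at[OF d1 d2])
  have "b' = 0" using eq[of 0] by (simp add: \<mu>.char_zero)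
  have W: "?W s = char \<mu> s * ?U s" for s
    using eq[of s] \<open>b' = 0\<close> \<mu>(4) by (cases "s = 0") (auto simp: mult.commute \<mu>.char_zero U.char_zero W.char_zero)
  show ?thesis
  proof (rule Levy_uniqueness)
    show "real_distribution (distr (\<mu> \<Otimes>\<^sub>M uniform_multiple \<pi>) borel (\<lambda>(x, y). x + y))"
      by (intro P.real_distribution_distr) simp
    show "?W = char (distr (\<mu> \<Otimes>\<^sub>M uniform_multiple \<pi>) borel (\<lambda>(x, y). x + y))"
    proof
      fix s
      have "char (distr (\<mu> \<Otimes>\<^sub>M uniform_multiple \<pi>) borel (\<lambda>(x, y). x + y)) s =
         (\<integral>p. iexp (s * (fst p + snd p)) \<partial>(\<mu> \<Otimes>\<^sub>M uniform_multiple \<pi>))"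
        unfolding char_def by (subst integral_distr) (auto simp: case_prod_beta')
      also have "\<dots> = (\<integral>x. \<integral>y. iexp (s * (x + y)) \<partial>uniform_multiple \<pi> \<partial>\<mu>)"
      proof (subst P.integral_fst'[symmetric])
        show "integrable (\<mu> \<Otimes>\<^sub>M uniform_multiple \<pi>) (\<lambda>p. iexp (s * (fst p + snd p)))"
          by (rule P.integrable_iexp) auto
      qed simp
      also have "\<dots> = (\<integral>x. \<integral>y. iexp (s * x) * iexp (s * y) \<partial>uniform_multiple \<pi> \<partial>\<mu>)"
        by (simp add: exp_add[symmetric] algebra_simps)
      also have "\<dots> = char \<mu> s * ?U s"
        by (simp add: char_def)
      finally show "?W s = char (distr (\<mu> \<Otimes>\<^sub>M uniform_multiple \<pi>) borel (\<lambda>(x, y). x + y)) s"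
        by (simp add: W)
    qed
  qed (fact W.real_distribution_axioms)
qed

section \<open>Exponential moments of uniform multiples\<close>

lemma nn_integral_unif_FTC:
  assumes "\<And>u. DERIV F u :> f u" "\<And>u. 0 \<le> f u" "f \<in> borel_measurable borel"
  shows "(\<integral>\<^sup>+u. ennreal (f u) \<partial>unif) = ennreal (F 1 - F 0)"
  using assms by (subst nn_integral_unif) (auto intro: nn_integral_FTC_Icc)

lemma mult_exp_minus_1_nonneg:
  fixes x s :: real
  assumes "0 \<le> s"
  shows "0 \<le> x * (exp (s * x) - 1)"
proof (cases "0 \<le> x")
  case False
  then have "s * x \<le> 0" using assms by (simp add: mult_nonneg_nonpos)
  then show ?thesis using False by (simp add: mult_nonpos_nonpos)
qed (use assms in simp)

text \<open>The next two lemmas integrate \<open>x\<^sup>2 s exp (s u x)\<close> over \<open>u \<in> (0,1)\<close> and then over \<open>s \<in> (0,t)\<close>.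
Every integrand is nonnegative whatever the sign of \<open>x\<close>, so all
integrations below may be interchanged in \<open>[0,\<infinity>]\<close>.\<close>

lemma exp_moment_kernel_inner:
  "(\<integral>\<^sup>+u. ennreal (x\<^sup>2 * (s * exp (s * (u * x)))) \<partial>unif) = ennreal (x * (exp (s * x) - 1))" if "0 \<le> s"
  using that
  by (subst nn_integral_unif_FTC[where F="\<lambda>u. x * exp (s * (u * x))"])
     (auto intro!: derivative_eq_intros mult_nonneg_nonneg simp: power2_eq_square right_diff_distrib)

lemma exp_moment_kernel_outer:
  "(\<integral>\<^sup>+s\<in>{0..t}. ennreal (x * (exp (s * x) - 1)) \<partial>lborel) = ennreal (exp (t * x) - 1 - t * x)" if "0 \<le> t"
proof -
  have "(\<integral>\<^sup>+s\<in>{0..t}. ennreal (x * (exp (s * x) - 1)) \<partial>lborel) =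
      ennreal ((exp (t * x) - t * x) - (exp (0 * x) - 0 * x))"
  proof (rule nn_integral_FTC_Icc[where F="\<lambda>s. exp (s * x) - s * x"])
    show "((\<lambda>s. exp (s * x) - s * x) has_real_derivative x * (exp (s * x) - 1)) (at s)" for s
      by (auto intro!: derivative_eq_intros simp: algebra_simps)
    show "0 \<le> x * (exp (s * x) - 1)" if "s \<in> {0..t}" for s
      using that by (intro mult_exp_minus_1_nonneg) simp
  qed (use that in simp_all)
  then show ?thesis by (simp add: algebra_simps)
qed

lemma nn_integral_square_biased:
  assumes [measurable_cong]: "sets \<mu> = sets borel" and [measurable]: "f \<in> borel_measurable borel"
  shows "(\<integral>\<^sup>+x. f x \<partial>square_biased V \<mu>) = (\<integral>\<^sup>+x. ennreal (x\<^sup>2 / V) * f x \<partial>\<mu>)"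
  unfolding square_biased_def by (subst nn_integral_density) auto

lemma measurable_mgf [measurable]:
  assumes "sigma_finite_measure \<pi>" and [measurable_cong]: "sets \<pi> = sets borel"
  shows "(\<lambda>s. mgf \<pi> (\<lambda>x. x) s) \<in> borel_measurable borel"
proof -
  interpret sigma_finite_measure \<pi> by fact
  show ?thesis unfolding mgf_def by measurable
qed

text \<open>The weight \<open>g\<close> is there for the truncation \<open>y \<le> A\<close> used further below.\<close>

lemma nn_integral_exp_uniform_multiple_square_biased:
  assumes \<mu>: "real_distribution \<mu>" "integrable \<mu> (\<lambda>x. x\<^sup>2)" "(\<integral>x. x\<^sup>2 \<partial>\<mu>) = V" "0 < V"
    and s: "0 \<le> s" and [measurable]: "g \<in> borel_measurable borel"
  shows "ennreal (V * s) * (\<integral>\<^sup>+y. ennreal (exp (s * y)) * g y \<partial>uniform_multiple (square_biased V \<mu>)) =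
    (\<integral>\<^sup>+x. \<integral>\<^sup>+u. ennreal (x\<^sup>2 * (s * exp (s * (u * x)))) * g (u * x) \<partial>unif \<partial>\<mu>)"
proof -
  interpret real_distribution \<mu> by fact
  have "(\<integral>\<^sup>+y. ennreal (exp (s * y)) * g y \<partial>uniform_multiple (square_biased V \<mu>)) =
      (\<integral>\<^sup>+x. ennreal (x\<^sup>2 / V) * (\<integral>\<^sup>+u. ennreal (exp (s * (u * x))) * g (u * x) \<partial>unif) \<partial>\<mu>)"
    by (subst nn_integral_uniform_multiple[OF real_distribution_square_biased[OF \<mu>]])
       (auto intro!: nn_integral_square_biased)
  then have "ennreal (V * s) * (\<integral>\<^sup>+y. ennreal (exp (s * y)) * g y \<partial>uniform_multiple (square_biased V \<mu>)) =
      (\<integral>\<^sup>+x. ennreal (V * s) * (ennreal (x\<^sup>2 / V) * (\<integral>\<^sup>+u. ennreal (exp (s * (u * x))) * g (u * x) \<partial>unif)) \<partial>\<mu>)"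
    by (simp add: nn_integral_cmult)
  also have "\<dots> = (\<integral>\<^sup>+x. \<integral>\<^sup>+u. ennreal (x\<^sup>2 * (s * exp (s * (u * x)))) * g (u * x) \<partial>unif \<partial>\<mu>)"
  proof (intro nn_integral_cong)
    fix x
    have "(\<integral>\<^sup>+u. ennreal (x\<^sup>2 * (s * exp (s * (u * x)))) * g (u * x) \<partial>unif) =
        (\<integral>\<^sup>+u. ennreal (x\<^sup>2 * s) * (ennreal (exp (s * (u * x))) * g (u * x)) \<partial>unif)"
      using s by (intro nn_integral_cong) (simp add: ennreal_mult mult.assoc)
    also have "\<dots> = ennreal (x\<^sup>2 * s) * (\<integral>\<^sup>+u. ennreal (exp (s * (u * x))) * g (u * x) \<partial>unif)"
      by (rule nn_integral_cmult) simp
    also have "ennreal (x\<^sup>2 * s) = ennreal (V * s) * ennreal (x\<^sup>2 / V)"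
      using \<mu>(4) s by (simp add: ennreal_mult[symmetric])
    finally show "ennreal (V * s) * (ennreal (x\<^sup>2 / V) * (\<integral>\<^sup>+u. ennreal (exp (s * (u * x))) * g (u * x) \<partial>unif)) =
       (\<integral>\<^sup>+u. ennreal (x\<^sup>2 * (s * exp (s * (u * x)))) * g (u * x) \<partial>unif)"
      by (simp add: mult.assoc)
  qed
  finally show ?thesis .
qed

lemma mgf_uniform_multiple_square_biased:
  assumes \<mu>: "real_distribution \<mu>" "integrable \<mu> (\<lambda>x. x\<^sup>2)" "(\<integral>x. x\<^sup>2 \<partial>\<mu>) = V" "0 < V" and s: "0 \<le> s"
  shows "ennreal (V * s) * mgf (uniform_multiple (square_biased V \<mu>)) (\<lambda>x. x) s =
    (\<integral>\<^sup>+x. ennreal (x * (exp (s * x) - 1)) \<partial>\<mu>)"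
  using nn_integral_exp_uniform_multiple_square_biased[OF assms, of "\<lambda>_. 1"] s
  by (simp add: mgf_def exp_moment_kernel_inner)

text \<open>A centered law does not see the linear term, even though \<open>c + t x\<close> may be negative.\<close>

lemma nn_integral_le_affine_add:
  assumes \<mu>: "prob_space \<mu>" and mean: "integrable \<mu> (\<lambda>x. x)" "(\<integral>x. x \<partial>\<mu>) = (0::real)"
    and [measurable]: "f \<in> borel_measurable \<mu>" "k \<in> borel_measurable \<mu>"
    and nn: "\<And>x. 0 \<le> f x" "\<And>x. 0 \<le> k x" "0 \<le> c" and le: "\<And>x. f x \<le> c + t * x + k x"
  shows "(\<integral>\<^sup>+x. ennreal (f x) \<partial>\<mu>) \<le> ennreal c + (\<integral>\<^sup>+x. ennreal (k x) \<partial>\<mu>)"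
proof (cases "(\<integral>\<^sup>+x. ennreal (k x) \<partial>\<mu>) = \<infinity>")
  case False
  interpret prob_space \<mu> by fact
  have k: "integrable \<mu> k"
    using False nn by (intro integrableI_nonneg) (auto simp: top.not_eq_extremum)
  have "(\<integral>\<^sup>+x. ennreal (f x) \<partial>\<mu>) \<le> (\<integral>\<^sup>+x. ennreal (c + t * x + k x) \<partial>\<mu>)"
    by (intro nn_integral_mono ennreal_leI le)
  also have "\<dots> = ennreal (\<integral>x. c + t * x + k x \<partial>\<mu>)"
    using mean k by (intro nn_integral_eq_integral) (auto intro!: AE_I2 order_trans[OF nn(1) le])
  also have "(\<integral>x. c + t * x + k x \<partial>\<mu>) = c + (\<integral>x. k x \<partial>\<mu>)"
    using mean k by (simp add: prob_space)
  also have "ennreal (c + (\<integral>x. k x \<partial>\<mu>)) = ennreal c + (\<integral>\<^sup>+x. ennreal (k x) \<partial>\<mu>)"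
    using nn k by (simp add: ennreal_plus nn_integral_eq_integral)
  finally show ?thesis .
qed simp

lemma mgf_convolution:
  assumes "real_distribution \<mu>" "real_distribution \<rho>"
  shows "mgf (distr (\<mu> \<Otimes>\<^sub>M \<rho>) borel (\<lambda>(x, y). x + y)) (\<lambda>x. x) s = mgf \<mu> (\<lambda>x. x) s * mgf \<rho> (\<lambda>x. x) s"
proof -
  interpret \<mu>: real_distribution \<mu> by fact
  interpret \<rho>: real_distribution \<rho> by fact
  have "mgf (distr (\<mu> \<Otimes>\<^sub>M \<rho>) borel (\<lambda>(x, y). x + y)) (\<lambda>x. x) s = (\<integral>\<^sup>+x. \<integral>\<^sup>+y. ennreal (exp (s * (x + y))) \<partial>\<rho> \<partial>\<mu>)"
    unfolding mgf_def by (subst nn_integral_distr) (auto simp: \<rho>.nn_integral_fst[symmetric])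
  also have "\<dots> = (\<integral>\<^sup>+x. \<integral>\<^sup>+y. ennreal (exp (s * x)) * ennreal (exp (s * y)) \<partial>\<rho> \<partial>\<mu>)"
    by (simp add: ennreal_mult[symmetric] exp_add[symmetric] algebra_simps)
  also have "\<dots> = mgf \<mu> (\<lambda>x. x) s * mgf \<rho> (\<lambda>x. x) s"
    by (simp add: mgf_def nn_integral_cmult nn_integral_multc)
  finally show ?thesis .
qed

lemma le_exp_minus_1: "y \<le> exp y - 1" for y :: real
  using exp_ge_add_one_self[of y] by linarith

text \<open>The kernel integrates to \<open>exp (t x) - 1 - t x\<close>. Passing from its integral to \<open>E exp (t X) - 1\<close> is
an equation in \<open>[0,\<infinity>]\<close>, which is proved as two inequalities.\<close>

lemma mgf_eq_1_plus_nn_integral: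
  assumes \<mu>: "real_distribution \<mu>" "integrable \<mu> (\<lambda>x. x\<^sup>2)" "(\<integral>x. x\<^sup>2 \<partial>\<mu>) = V" "0 < V"
    and mean: "integrable \<mu> (\<lambda>x. x)" "(\<integral>x. x \<partial>\<mu>) = 0" and t: "0 \<le> t"
  shows "mgf \<mu> (\<lambda>x. x) t =
    1 + (\<integral>\<^sup>+s\<in>{0..t}. ennreal (V * s) * mgf (uniform_multiple (square_biased V \<mu>)) (\<lambda>x. x) s \<partial>lborel)"
proof -
  interpret real_distribution \<mu> by fact
  interpret P: pair_sigma_finite lborel \<mu> ..
  have "(\<integral>\<^sup>+s\<in>{0..t}. ennreal (V * s) * mgf (uniform_multiple (square_biased V \<mu>)) (\<lambda>x. x) s \<partial>lborel)
    = (\<integral>\<^sup>+s. (\<integral>\<^sup>+x. ennreal (x * (exp (s * x) - 1)) * indicator {0..t} s \<partial>\<mu>) \<partial>lborel)"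
    by (intro nn_integral_cong) (auto simp: mgf_uniform_multiple_square_biased[OF \<mu>] indicator_def)
  also have "\<dots> = (\<integral>\<^sup>+x. (\<integral>\<^sup>+s\<in>{0..t}. ennreal (x * (exp (s * x) - 1)) \<partial>lborel) \<partial>\<mu>)"
    by (rule P.Fubini'[symmetric]) simp
  also have "\<dots> = (\<integral>\<^sup>+x. ennreal (exp (t * x) - 1 - t * x) \<partial>\<mu>)"
    using t by (simp add: exp_moment_kernel_outer)
  also have "1 + \<dots> = mgf \<mu> (\<lambda>x. x) t"
  proof (rule antisym)
    have "1 + (\<integral>\<^sup>+x. ennreal (exp (t * x) - 1 - t * x) \<partial>\<mu>) = (\<integral>\<^sup>+x. 1 + ennreal (exp (t * x) - 1 - t * x) \<partial>\<mu>)"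
      using emeasure_space_1 by (subst nn_integral_add) auto
    also have "\<dots> = (\<integral>\<^sup>+x. ennreal (1 + (exp (t * x) - 1 - t * x)) \<partial>\<mu>)"
      by (intro nn_integral_cong, subst ennreal_plus) (auto simp: le_exp_minus_1)
    also have "\<dots> \<le> ennreal 0 + (\<integral>\<^sup>+x. ennreal (exp (t * x)) \<partial>\<mu>)"
      by (rule nn_integral_le_affine_add[OF prob_space_axioms mean, where t="-t"])
        (auto simp: le_exp_minus_1 algebra_simps intro: order_trans[OF le_exp_minus_1])
    finally show "1 + (\<integral>\<^sup>+x. ennreal (exp (t * x) - 1 - t * x) \<partial>\<mu>) \<le> mgf \<mu> (\<lambda>x. x) t"
      by (simp add: mgf_def)
    have "mgf \<mu> (\<lambda>x. x) t \<le> ennreal 1 + (\<integral>\<^sup>+x. ennreal (exp (t * x) - 1 - t * x) \<partial>\<mu>)"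
      unfolding mgf_def
      by (rule nn_integral_le_affine_add[OF prob_space_axioms mean, where t=t]) (auto simp: le_exp_minus_1)
    then show "mgf \<mu> (\<lambda>x. x) t \<le> 1 + (\<integral>\<^sup>+x. ennreal (exp (t * x) - 1 - t * x) \<partial>\<mu>)" by simp
  qed
  finally show ?thesis by simp
qed

section \<open>Regularity of moment generating functions\<close>

lemma exp_mult_le_1_plus: "exp (s * x) \<le> 1 + exp (t * x)" if "0 \<le> s" "s \<le> t" for s t x :: real
proof (cases "0 \<le> x")
  case True
  then have "exp (s * x) \<le> exp (t * x)" using that by (simp add: mult_right_mono)
  then show ?thesis by linarith
next
  case False
  then have "exp (s * x) \<le> 1" using that by (simp add: mult_nonneg_nonpos)
  then show ?thesis using exp_gt_zero[of "t * x"] by linarith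
qed

lemma mgf_le_1_plus_mgf:
  assumes "real_distribution \<pi>" "0 \<le> s" "s \<le> t"
  shows "mgf \<pi> (\<lambda>x. x) s \<le> 1 + mgf \<pi> (\<lambda>x. x) t"
proof -
  interpret real_distribution \<pi> by fact
  have "mgf \<pi> (\<lambda>x. x) s \<le> (\<integral>\<^sup>+x. 1 + ennreal (exp (t * x)) \<partial>\<pi>)"
    unfolding mgf_def
  proof (intro nn_integral_mono)
    fix x
    have "ennreal (exp (s * x)) \<le> ennreal (1 + exp (t * x))" by (intro ennreal_leI exp_mult_le_1_plus assms)
    then show "ennreal (exp (s * x)) \<le> 1 + ennreal (exp (t * x))" by simp
  qed
  also have "\<dots> = 1 + mgf \<pi> (\<lambda>x. x) t"
    unfolding mgf_def using emeasure_space_1 by (subst nn_integral_add) auto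
  finally show ?thesis .
qed

lemma integrable_exp_iff_mgf:
  assumes "real_distribution \<pi>"
  shows "integrable \<pi> (\<lambda>x. exp (s * x)) \<longleftrightarrow> mgf \<pi> (\<lambda>x. x) s < \<infinity>"
proof -
  interpret real_distribution \<pi> by fact
  show ?thesis by (simp add: integrable_iff_bounded mgf_def)
qed

lemma continuous_on_mgf:
  assumes "real_distribution \<pi>" "mgf \<pi> (\<lambda>x. x) T < \<infinity>"
  shows "continuous_on {0..T} (\<lambda>s. enn2real (mgf \<pi> (\<lambda>x. x) s))"
proof -
  interpret real_distribution \<pi> by fact
  have eq: "enn2real (mgf \<pi> (\<lambda>x. x) s) = (\<integral>x. exp (s * x) \<partial>\<pi>)" for s
    unfolding mgf_def by (subst integral_eq_nn_integral) auto
  have "continuous_on {0..T} (\<lambda>s. \<integral>x. exp (s * x) \<partial>\<pi>)"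
    unfolding continuous_on_sequentially comp_def
  proof safe
    fix X t assume X: "\<forall>n. X n \<in> {0..T}" "X \<longlonglongrightarrow> t"
    show "(\<lambda>n. \<integral>x. exp (X n * x) \<partial>\<pi>) \<longlonglongrightarrow> (\<integral>x. exp (t * x) \<partial>\<pi>)"
    proof (rule integral_dominated_convergence)
      show "integrable \<pi> (\<lambda>x. 1 + exp (T * x))"
        using assms integrable_exp_iff_mgf by auto
      show "AE x in \<pi>. norm (exp (X n * x)) \<le> 1 + exp (T * x)" for n
        using X by (auto intro!: exp_mult_le_1_plus)
      show "AE x in \<pi>. (\<lambda>n. exp (X n * x)) \<longlonglongrightarrow> exp (t * x)"
        using X by (auto intro!: tendsto_intros)
    qed auto
  qed
  then show ?thesis by (simp add: eq)
qed

text \<open>Fatou's lemma bounds the lower limit from below. Convexity of the exponential bounds the value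
at \<open>r t\<close> by the convex combination of the values at \<open>0\<close> and \<open>t\<close>, which controls the upper limit
also when the value at \<open>t\<close> is infinite.\<close>

lemma mgf_left_limit:
  assumes "real_distribution \<pi>" "0 < t"
  shows "(\<lambda>n. mgf \<pi> (\<lambda>x. x) (t * (1 - 1 / real (n + 2)))) \<longlonglongrightarrow> mgf \<pi> (\<lambda>x. x) t"
proof -
  interpret real_distribution \<pi> by fact
  define r where "r n = 1 - 1 / real (n + 2)" for n
  have r: "0 < r n" "r n < 1" for n by (auto simp: r_def field_simps)
  have r_lim: "r \<longlonglongrightarrow> 1" unfolding r_def by real_asymp
  let ?m = "\<lambda>n. mgf \<pi> (\<lambda>x. x) (t * r n)"
  have le: "?m n \<le> ennreal (1 - r n) + ennreal (r n) * mgf \<pi> (\<lambda>x. x) t" for n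
  proof -
    have "?m n \<le> (\<integral>\<^sup>+x. ennreal (1 - r n) + ennreal (r n) * ennreal (exp (t * x)) \<partial>\<pi>)"
      unfolding mgf_def
    proof (intro nn_integral_mono)
      fix x
      have "exp ((1 - r n) *\<^sub>R 0 + r n *\<^sub>R (t * x)) \<le> (1 - r n) * exp 0 + r n * exp (t * x)"
        using r[of n] by (intro convex_onD[OF exp_convex]) auto
      then have "exp (t * r n * x) \<le> (1 - r n) + r n * exp (t * x)" by (simp add: mult_ac)
      then have "ennreal (exp (t * r n * x)) \<le> ennreal ((1 - r n) + r n * exp (t * x))" by (rule ennreal_leI)
      also have "\<dots> = ennreal (1 - r n) + ennreal (r n) * ennreal (exp (t * x))"
        using r[of n] by (simp add: ennreal_plus ennreal_mult)
      finally show "ennreal (exp (t * r n * x)) \<le> ennreal (1 - r n) + ennreal (r n) * ennreal (exp (t * x))" .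
    qed
    also have "\<dots> = ennreal (1 - r n) + ennreal (r n) * mgf \<pi> (\<lambda>x. x) t"
      unfolding mgf_def using emeasure_space_1 by (subst nn_integral_add) (auto simp: nn_integral_cmult)
    finally show ?thesis .
  qed
  have "(\<lambda>n. ennreal (1 - r n) + ennreal (r n) * mgf \<pi> (\<lambda>x. x) t) \<longlonglongrightarrow> ennreal (1 - 1) + ennreal 1 * mgf \<pi> (\<lambda>x. x) t"
    by (intro tendsto_add tendsto_ennrealI tendsto_mult_ennreal tendsto_intros r_lim) auto
  then have lim: "(\<lambda>n. ennreal (1 - r n) + ennreal (r n) * mgf \<pi> (\<lambda>x. x) t) \<longlonglongrightarrow> mgf \<pi> (\<lambda>x. x) t" by simp
  have "mgf \<pi> (\<lambda>x. x) t = (\<integral>\<^sup>+x. liminf (\<lambda>n. ennreal (exp (t * r n * x))) \<partial>\<pi>)"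
    unfolding mgf_def
  proof (intro nn_integral_cong sym[OF lim_imp_Liminf])
    fix x
    have "(\<lambda>n. ennreal (exp (t * r n * x))) \<longlonglongrightarrow> ennreal (exp (t * 1 * x))"
      by (intro tendsto_ennrealI tendsto_intros r_lim)
    then show "(\<lambda>n. ennreal (exp (t * r n * x))) \<longlonglongrightarrow> ennreal (exp (t * x))" by simp
  qed simp
  also have "\<dots> \<le> liminf ?m"
    unfolding mgf_def by (rule nn_integral_liminf) simp
  finally have 1: "mgf \<pi> (\<lambda>x. x) t \<le> liminf ?m" .
  have "limsup ?m \<le> limsup (\<lambda>n. ennreal (1 - r n) + ennreal (r n) * mgf \<pi> (\<lambda>x. x) t)"
    by (intro Limsup_mono always_eventually allI le)
  also have "\<dots> = mgf \<pi> (\<lambda>x. x) t" by (intro lim_imp_Limsup lim) simp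
  finally have 2: "limsup ?m \<le> mgf \<pi> (\<lambda>x. x) t" .
  have "?m \<longlonglongrightarrow> mgf \<pi> (\<lambda>x. x) t"
    using 1 2 Liminf_le_Limsup[of sequentially ?m] by (intro Liminf_eq_Limsup) auto
  then show ?thesis by (simp add: r_def)
qed

section \<open>Gronwall's inequality and linear Volterra equations\<close>

text \<open>Only the finiteness of the a priori bound \<open>D\<close> matters. Let \<open>S\<close> be the supremum of
\<open>m t exp (- 2 C t)\<close>. The integral inequality gives \<open>S \<le> 1 + S / 2\<close>, so \<open>S \<le> 2\<close> because \<open>S\<close> is finite.\<close>

lemma gronwall_nn_integral:
  fixes m :: "real \<Rightarrow> ennreal"
  assumes [measurable]: "m \<in> borel_measurable borel" and C: "0 < C"
    and bd: "\<And>t. t \<in> {0..T} \<Longrightarrow> m t \<le> ennreal D"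
    and le: "\<And>t. t \<in> {0..T} \<Longrightarrow> m t \<le> 1 + ennreal C * (\<integral>\<^sup>+s\<in>{0..t}. m s \<partial>lborel)"
    and t: "t \<in> {0..T}"
  shows "m t \<le> ennreal (2 * exp (2 * C * t))"
proof -
  define S where "S = (SUP t\<in>{0..T}. m t * ennreal (exp (- (2 * C * t))))"
  have m_le: "m s \<le> S * ennreal (exp (2 * C * s))" if "s \<in> {0..T}" for s
  proof -
    have "m s = m s * ennreal (exp (- (2 * C * s))) * ennreal (exp (2 * C * s))"
      by (simp add: mult.assoc ennreal_mult[symmetric] exp_add[symmetric])
    also have "\<dots> \<le> S * ennreal (exp (2 * C * s))"
      unfolding S_def by (intro mult_right_mono SUP_upper that) simp
    finally show ?thesis .
  qed
  have "S \<le> ennreal D"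
    unfolding S_def
  proof (rule SUP_least)
    fix s assume s: "s \<in> {0..T}"
    have "m s * ennreal (exp (- (2 * C * s))) \<le> ennreal D * ennreal 1"
      using s C by (intro mult_mono bd ennreal_leI) auto
    then show "m s * ennreal (exp (- (2 * C * s))) \<le> ennreal D" by simp
  qed
  then have S_fin: "S < \<infinity>" by (rule le_less_trans) simp
  define r where "r = enn2real S"
  have r: "S = ennreal r" "0 \<le> r" using S_fin by (auto simp: r_def)
  have "S \<le> ennreal (1 + r / 2)"
    unfolding S_def
  proof (rule SUP_least)
    fix t assume t: "t \<in> {0..T}"
    have "(\<integral>\<^sup>+s\<in>{0..t}. m s \<partial>lborel) \<le> (\<integral>\<^sup>+s. ennreal (r * exp (2 * C * s)) * indicator {0..t} s \<partial>lborel)"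
      using t r by (intro nn_integral_mono) (auto simp: indicator_def ennreal_mult intro!: order_trans[OF m_le])
    also have "\<dots> = ennreal (r * exp (2 * C * t) / (2 * C) - r * exp (2 * C * 0) / (2 * C))"
      using t C r by (intro nn_integral_FTC_Icc) (auto intro!: derivative_eq_intros)
    finally have I: "1 + ennreal C * (\<integral>\<^sup>+s\<in>{0..t}. m s \<partial>lborel)
        \<le> 1 + ennreal C * ennreal (r * exp (2 * C * t) / (2 * C) - r * exp (2 * C * 0) / (2 * C))"
      by (intro add_left_mono mult_left_mono) auto
    have "m t \<le> 1 + ennreal C * ennreal (r * exp (2 * C * t) / (2 * C) - r / (2 * C))"
      by (rule order_trans[OF le[OF t]]) (use I in simp)
    also have "\<dots> = ennreal (1 + C * (r * exp (2 * C * t) / (2 * C) - r / (2 * C)))"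
    proof -
      have "r * 1 \<le> r * exp (2 * C * t)" using r C t by (intro mult_left_mono) auto
      then have "0 \<le> r * exp (2 * C * t) / (2 * C) - r / (2 * C)" using C by (simp add: divide_right_mono)
      then show ?thesis using C by (subst ennreal_plus) (auto simp: ennreal_mult)
    qed
    also have "C * (r * exp (2 * C * t) / (2 * C) - r / (2 * C)) = r / 2 * (exp (2 * C * t) - 1)"
      using C by (simp add: field_simps)
    finally have "m t * ennreal (exp (- (2 * C * t))) \<le> ennreal (1 + r / 2 * (exp (2 * C * t) - 1)) * ennreal (exp (- (2 * C * t)))"
      by (intro mult_right_mono) auto
    also have "\<dots> = ennreal ((1 + r / 2 * (exp (2 * C * t) - 1)) * exp (- (2 * C * t)))"
      by (simp add: ennreal_mult'')
    also have "\<dots> \<le> ennreal (1 + r / 2)"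
    proof (rule ennreal_leI)
      have "(1 + r / 2 * (exp (2 * C * t) - 1)) * exp (- (2 * C * t)) = exp (- (2 * C * t)) + r / 2 * (1 - exp (- (2 * C * t)))"
        by (simp add: algebra_simps exp_minus)
      also have "\<dots> \<le> 1 + r / 2 * 1"
        using C t r by (intro add_mono mult_left_mono) auto
      finally show "(1 + r / 2 * (exp (2 * C * t) - 1)) * exp (- (2 * C * t)) \<le> 1 + r / 2" by simp
    qed
    finally show "m t * ennreal (exp (- (2 * C * t))) \<le> ennreal (1 + r / 2)" .
  qed
  then have "r \<le> 1 + r / 2" unfolding r(1) by (subst (asm) ennreal_le_iff) (use r(2) in auto)
  then have "r \<le> 2" by simp
  then have "S * ennreal (exp (2 * C * t)) \<le> ennreal 2 * ennreal (exp (2 * C * t))"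
    unfolding r(1) by (intro mult_right_mono ennreal_leI) auto
  then show ?thesis
    using m_le[OF t] by (simp add: ennreal_mult order_trans)
qed

lemma nn_integral_Icc_continuous:
  fixes f :: "real \<Rightarrow> real"
  assumes "continuous_on {a..b} f" "\<And>x. x \<in> {a..b} \<Longrightarrow> 0 \<le> f x"
  shows "(\<integral>\<^sup>+x\<in>{a..b}. ennreal (f x) \<partial>lborel) = ennreal (integral {a..b} f)"
proof -
  have int: "set_integrable lborel {a..b} f"
    unfolding set_integrable_def by (rule borel_integrable_compact) (use assms in auto)
  have "(\<integral>\<^sup>+x\<in>{a..b}. ennreal (f x) \<partial>lborel) = (\<integral>\<^sup>+x. ennreal (indicator {a..b} x *\<^sub>R f x) \<partial>lborel)"
    by (intro nn_integral_cong) (auto simp: indicator_def)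
  also have "\<dots> = ennreal (LINT x:{a..b}|lborel. f x)"
    unfolding set_lebesgue_integral_def
    by (rule nn_integral_eq_integral) (use int assms(2) in \<open>auto simp: set_integrable_def indicator_def\<close>)
  also have "(LINT x:{a..b}|lborel. f x) = integral {a..b} f"
    by (rule set_borel_integral_eq_integral(2)[OF int])
  finally show ?thesis .
qed

lemma linear_volterra_solution:
  fixes m h :: "real \<Rightarrow> real"
  assumes m: "continuous_on {0..T} m" and h: "continuous_on {0..T} h"
    and eq: "\<And>t. t \<in> {0..T} \<Longrightarrow> m t = 1 + integral {0..t} (\<lambda>s. h s * m s)"
    and t: "t \<in> {0..T}"
  shows "m t = exp (integral {0..t} h)"
proof -
  have dm: "(m has_real_derivative h s * m s) (at s within {0..T})" if s: "s \<in> {0..T}" for s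
  proof -
    have "((\<lambda>t. integral {0..t} (\<lambda>s. h s * m s)) has_real_derivative h s * m s) (at s within {0..T})"
      by (rule integral_has_real_derivative[OF _ s]) (intro continuous_intros m h)
    then have "((\<lambda>t. 1 + integral {0..t} (\<lambda>s. h s * m s)) has_real_derivative h s * m s) (at s within {0..T})"
      by (auto intro!: derivative_eq_intros)
    then show ?thesis
      by (rule has_field_derivative_transform_within[OF _ zero_less_one s]) (simp add: eq)
  qed
  have dh: "((\<lambda>t. integral {0..t} h) has_real_derivative h s) (at s within {0..T})" if s: "s \<in> {0..T}" for s
    by (rule integral_has_real_derivative[OF h s])
  \<comment> \<open>The integrating factor \<open>exp (- \<integral>h)\<close> makes the solution constant.\<close>
  have "\<exists>c. \<forall>s\<in>{0..T}. m s * exp (- integral {0..s} h) = c"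
  proof (rule has_field_derivative_zero_constant)
    fix s assume s: "s \<in> {0..T}"
    show "((\<lambda>s. m s * exp (- integral {0..s} h)) has_real_derivative 0) (at s within {0..T})"
      by (rule derivative_eq_intros dm[OF s] dh[OF s] refl | simp)+
  qed simp
  then obtain c where c: "\<And>s. s \<in> {0..T} \<Longrightarrow> m s * exp (- integral {0..s} h) = c" by blast
  have "c = 1" using c[of 0] eq[of 0] t by simp
  then show ?thesis using c[OF t] by (simp add: exp_minus field_simps)
qed

section \<open>The moment generating function under the zero-bias identity\<close>

text \<open>For \<open>x \<le> A\<close> the truncation has no effect and equality holds. For \<open>x > A\<close> the kernel equals
\<open>(x / A) (exp (t A) - 1 - t A)\<close>, and \<open>x / A \<ge> 1\<close>.\<close>

lemma truncated_exp_moment_kernel: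
  fixes x t A :: real
  assumes t: "0 \<le> t" and A: "0 < A"
  shows "\<exists>k\<ge>0. (\<integral>\<^sup>+s\<in>{0..t}. (\<integral>\<^sup>+u. ennreal (x\<^sup>2 * (s * exp (s * (u * x)))) * indicator {..A} (u * x) \<partial>unif) \<partial>lborel) = ennreal k \<and>
    min (exp (t * x)) (exp (t * A)) \<le> 1 + t * x + k"
proof (cases "x \<le> A")
  case True
  have "u * x \<le> A" if "0 \<le> u" "u \<le> 1" for u
  proof (cases "0 \<le> x")
    case True
    then show ?thesis using \<open>x \<le> A\<close> that mult_left_le_one_le[of x u] by auto
  next
    case False
    then have "u * x \<le> 0" using that by (simp add: mult_nonneg_nonpos)
    then show ?thesis using A by linarith
  qed
  then have "(\<integral>\<^sup>+u. ennreal (x\<^sup>2 * (s * exp (s * (u * x)))) * indicator {..A} (u * x) \<partial>unif)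
      = (\<integral>\<^sup>+u. ennreal (x\<^sup>2 * (s * exp (s * (u * x)))) \<partial>unif)" for s
    by (auto simp: nn_integral_unif indicator_def intro!: nn_integral_cong)
  then have "(\<integral>\<^sup>+s\<in>{0..t}. (\<integral>\<^sup>+u. ennreal (x\<^sup>2 * (s * exp (s * (u * x)))) * indicator {..A} (u * x) \<partial>unif) \<partial>lborel)
      = (\<integral>\<^sup>+s\<in>{0..t}. ennreal (x * (exp (s * x) - 1)) \<partial>lborel)"
    by (auto simp: exp_moment_kernel_inner indicator_def intro!: nn_integral_cong)
  also have "\<dots> = ennreal (exp (t * x) - 1 - t * x)" by (rule exp_moment_kernel_outer[OF t])
  finally show ?thesis by (intro exI[of _ "exp (t * x) - 1 - t * x"]) (auto simp: le_exp_minus_1)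
next
  case False
  then have x: "A < x" "0 < x" using A by auto
  have u1: "u \<le> 1" if "u * x \<le> A" for u
  proof (rule ccontr)
    assume "\<not> u \<le> 1"
    then have "1 * x \<le> u * x" using x by (intro mult_right_mono) auto
    with that x show False by simp
  qed
  have inner: "(\<integral>\<^sup>+u. ennreal (x\<^sup>2 * (s * exp (s * (u * x)))) * indicator {..A} (u * x) \<partial>unif) = ennreal (x * (exp (s * A) - 1))"
    if s: "0 \<le> s" for s
  proof -
    have "(\<integral>\<^sup>+u. ennreal (x\<^sup>2 * (s * exp (s * (u * x)))) * indicator {..A} (u * x) \<partial>unif)
       = (\<integral>\<^sup>+u\<in>{0..A / x}. ennreal (x\<^sup>2 * (s * exp (s * (u * x)))) \<partial>lborel)"
      using x A by (subst nn_integral_unif) (auto intro!: nn_integral_cong simp: indicator_def pos_le_divide_eq dest: u1)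
    also have "\<dots> = ennreal (x * exp (s * (A / x * x)) - x * exp (s * (0 * x)))"
      using s x A by (intro nn_integral_FTC_Icc) (auto intro!: derivative_eq_intros simp: power2_eq_square)
    finally show ?thesis using x by (simp add: right_diff_distrib)
  qed
  define k where "k = x * (exp (t * A) / A - t) - x * (exp (0 * A) / A - 0)"
  have "(\<integral>\<^sup>+s\<in>{0..t}. (\<integral>\<^sup>+u. ennreal (x\<^sup>2 * (s * exp (s * (u * x)))) * indicator {..A} (u * x) \<partial>unif) \<partial>lborel)
      = (\<integral>\<^sup>+s\<in>{0..t}. ennreal (x * (exp (s * A) - 1)) \<partial>lborel)"
  proof (rule nn_integral_cong)
    fix s :: real
    show "(\<integral>\<^sup>+u. ennreal (x\<^sup>2 * (s * exp (s * (u * x)))) * indicator {..A} (u * x) \<partial>unif) * indicator {0..t} s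
        = ennreal (x * (exp (s * A) - 1)) * indicator {0..t} s"
      using inner[of s] by (cases "s \<in> {0..t}") auto
  qed
  also have "\<dots> = ennreal k"
    unfolding k_def
    using t x A by (intro nn_integral_FTC_Icc) (auto intro!: derivative_eq_intros simp: field_simps)
  finally have eq: "(\<integral>\<^sup>+s\<in>{0..t}. (\<integral>\<^sup>+u. ennreal (x\<^sup>2 * (s * exp (s * (u * x)))) * indicator {..A} (u * x) \<partial>unif) \<partial>lborel) = ennreal k" .
  have k: "k = x / A * (exp (t * A) - 1 - t * A)" using A by (simp add: k_def field_simps)
  have k0: "0 \<le> k" unfolding k using x A by (intro mult_nonneg_nonneg) (auto simp: le_exp_minus_1)
  have "1 * (exp (t * A) - 1) \<le> x / A * (exp (t * A) - 1)"
    using x A t by (intro mult_right_mono) (auto simp: field_simps)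
  then have "exp (t * A) \<le> 1 + t * x + k" using A unfolding k by (simp add: field_simps)
  then show ?thesis using eq k0 by (intro exI[of _ k]) auto
qed

text \<open>From here on only the equality of laws \<open>U W = X + U Z\<close> is used; \<open>\<rho>\<close> is the law of \<open>U Z\<close>.\<close>

locale zero_bias_identity =
  fixes \<mu> \<rho> :: "real measure" and V :: real
  assumes \<mu>: "real_distribution \<mu>" "integrable \<mu> (\<lambda>x. x\<^sup>2)" "(\<integral>x. x\<^sup>2 \<partial>\<mu>) = V" "0 < V"
    and mean: "integrable \<mu> (\<lambda>x. x)" "(\<integral>x. x \<partial>\<mu>) = 0"
    and \<rho>: "real_distribution \<rho>"
    and identity: "uniform_multiple (square_biased V \<mu>) = distr (\<mu> \<Otimes>\<^sub>M \<rho>) borel (\<lambda>(x, y). x + y)"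
begin

sublocale \<mu>: real_distribution \<mu> by (fact \<mu>)
sublocale \<rho>: real_distribution \<rho> by (fact \<rho>)

abbreviation "M \<equiv> mgf \<mu> (\<lambda>x. x)"
abbreviation "G \<equiv> mgf \<rho> (\<lambda>x. x)"

lemma meas_M [measurable]: "M \<in> borel_measurable borel"
  by (rule measurable_mgf) (unfold_locales, simp)

lemma meas_G [measurable]: "G \<in> borel_measurable borel"
  by (rule measurable_mgf) (unfold_locales, simp)

text \<open>Together with the definition of \<open>\<kappa>\<close> below this suggests \<open>M = exp \<kappa>\<close>. The equation alone does not imply it: it
does not exclude that \<open>M\<close> jumps to infinity while \<open>G\<close> is still finite.\<close>

lemma volterra:
  assumes "0 \<le> t"
  shows "M t = 1 + (\<integral>\<^sup>+s\<in>{0..t}. ennreal (V * s) * (M s * G s) \<partial>lborel)"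
  using mgf_eq_1_plus_nn_integral[OF \<mu> mean assms]
  by (simp add: identity mgf_convolution[OF \<mu>(1) \<rho>])

text \<open>The bounded function \<open>min (exp (t x)) (exp (t A))\<close> and not \<open>exp (t x)\<close> restricted to \<open>x \<le> A\<close>: since
\<open>U Z\<close> may be negative, \<open>X + U Z \<le> A\<close> does not give \<open>X \<le> A\<close>.\<close>

definition trunc :: "real \<Rightarrow> real \<Rightarrow> ennreal" where
  "trunc A t = (\<integral>\<^sup>+x. ennreal (min (exp (t * x)) (exp (t * A))) \<partial>\<mu>)"

lemma meas_trunc [measurable]: "trunc A \<in> borel_measurable borel"
  unfolding trunc_def by measurable

lemma trunc_le_add_integral:
  assumes t: "0 \<le> t" and A: "0 < A"
  shows "trunc A t \<le> 1 + (\<integral>\<^sup>+s\<in>{0..t}. ennreal (V * s) * (\<integral>\<^sup>+y. ennreal (exp (s * y)) * indicator {..A} y \<partial>uniform_multiple (square_biased V \<mu>)) \<partial>lborel)"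
proof -
  interpret P: pair_sigma_finite lborel \<mu> ..
  define K where "K x = (\<integral>\<^sup>+s\<in>{0..t}. (\<integral>\<^sup>+u. ennreal (x\<^sup>2 * (s * exp (s * (u * x)))) * indicator {..A} (u * x) \<partial>unif) \<partial>lborel)" for x
  have [measurable]: "K \<in> borel_measurable borel" unfolding K_def by measurable
  have K: "K x < \<infinity>" "min (exp (t * x)) (exp (t * A)) \<le> 1 + t * x + enn2real (K x)" for x
    using truncated_exp_moment_kernel[OF t A, of x] by (auto simp: K_def)
  have "trunc A t \<le> ennreal 1 + (\<integral>\<^sup>+x. ennreal (enn2real (K x)) \<partial>\<mu>)"
    unfolding trunc_def using K(2) by (intro nn_integral_le_affine_add[OF \<mu>.prob_space_axioms mean]) auto
  also have "(\<integral>\<^sup>+x. ennreal (enn2real (K x)) \<partial>\<mu>) = (\<integral>\<^sup>+x. K x \<partial>\<mu>)"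
    using K(1) by simp
  also have "\<dots> = (\<integral>\<^sup>+s. \<integral>\<^sup>+x. (\<integral>\<^sup>+u. ennreal (x\<^sup>2 * (s * exp (s * (u * x)))) * indicator {..A} (u * x) \<partial>unif) * indicator {0..t} s \<partial>\<mu> \<partial>lborel)"
    unfolding K_def by (rule P.Fubini') simp
  also have "\<dots> = (\<integral>\<^sup>+s\<in>{0..t}. ennreal (V * s) * (\<integral>\<^sup>+y. ennreal (exp (s * y)) * indicator {..A} y \<partial>uniform_multiple (square_biased V \<mu>)) \<partial>lborel)"
  proof (rule nn_integral_cong)
    fix s :: real
    show "(\<integral>\<^sup>+x. (\<integral>\<^sup>+u. ennreal (x\<^sup>2 * (s * exp (s * (u * x)))) * indicator {..A} (u * x) \<partial>unif) * indicator {0..t} s \<partial>\<mu>)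
      = ennreal (V * s) * (\<integral>\<^sup>+y. ennreal (exp (s * y)) * indicator {..A} y \<partial>uniform_multiple (square_biased V \<mu>)) * indicator {0..t} s"
    proof (cases "s \<in> {0..t}")
      case True
      then show ?thesis
        using nn_integral_exp_uniform_multiple_square_biased[OF \<mu>, of s "indicator {..A}"] by simp
    qed simp
  qed
  finally show ?thesis by simp
qed

lemma truncated_convolution_le:
  assumes s: "0 \<le> s"
  shows "(\<integral>\<^sup>+y. ennreal (exp (s * y)) * indicator {..A} y \<partial>uniform_multiple (square_biased V \<mu>))
    \<le> trunc A s * (1 + G s)"
proof -
  have "(\<integral>\<^sup>+y. ennreal (exp (s * y)) * indicator {..A} y \<partial>uniform_multiple (square_biased V \<mu>))
     = (\<integral>\<^sup>+x. \<integral>\<^sup>+y. ennreal (exp (s * (x + y))) * indicator {..A} (x + y) \<partial>\<rho> \<partial>\<mu>)"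
    unfolding identity by (subst nn_integral_distr) (auto simp: \<rho>.nn_integral_fst[symmetric])
  also have "\<dots> \<le> (\<integral>\<^sup>+x. \<integral>\<^sup>+y. ennreal (min (exp (s * x)) (exp (s * A))) * (1 + ennreal (exp (s * y))) \<partial>\<rho> \<partial>\<mu>)"
  proof (intro nn_integral_mono)
    fix x y :: real
    have "exp (s * (x + y)) \<le> min (exp (s * x)) (exp (s * A)) * (1 + exp (s * y))" if le: "x + y \<le> A"
    proof (cases "x \<le> A")
      case True
      then have "min (exp (s * x)) (exp (s * A)) = exp (s * x)" using s by (simp add: min_def mult_left_mono)
      then show ?thesis by (simp add: distrib_left exp_add)
    next
      case False
      then have m: "min (exp (s * x)) (exp (s * A)) = exp (s * A)" using s by (simp add: min_absorb2 mult_left_mono)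
      have "exp (s * (x + y)) \<le> exp (s * A)" using le s by (simp add: mult_left_mono)
      also have "exp (s * A) \<le> exp (s * A) * (1 + exp (s * y))" by (simp add: distrib_left)
      finally show ?thesis unfolding m .
    qed
    then show "ennreal (exp (s * (x + y))) * indicator {..A} (x + y) \<le> ennreal (min (exp (s * x)) (exp (s * A))) * (1 + ennreal (exp (s * y)))"
      by (auto simp: indicator_def ennreal_mult[symmetric] ennreal_plus[symmetric] simp del: ennreal_plus
           simp flip: ennreal_1 intro!: ennreal_leI)
  qed
  also have "\<dots> = trunc A s * (1 + G s)"
    unfolding trunc_def mgf_def
    by (simp add: nn_integral_cmult nn_integral_multc nn_integral_add \<rho>.emeasure_space_1[simplified])
  finally show ?thesis .
qed

text \<open>The truncated moment generating functions satisfy the Volterra equation as an inequality with a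
bounded kernel, so Gronwall's inequality bounds them uniformly in the level \<open>A\<close>.\<close>

lemma mgf_finite_if_mgf_step_finite:
  assumes T: "0 < T" and fin: "G T < \<infinity>"
  shows "M T < \<infinity>"
proof -
  \<comment> \<open>\<open>C\<close> bounds \<open>V s (1 + G s)\<close> on \<open>[0,T]\<close>, because \<open>G s \<le> 1 + G T\<close> there.\<close>
  define C where "C = V * T * (2 + enn2real (G T))"
  have C: "0 < C" using T \<mu>(4) by (auto simp: C_def intro!: mult_pos_pos add_pos_nonneg)
  have GT: "G T = ennreal (enn2real (G T))" using fin by simp
  have bound: "trunc A T \<le> ennreal (2 * exp (2 * C * T))" if A: "0 < A" for A
  proof (rule gronwall_nn_integral[OF meas_trunc C, where T=T and D="exp (T * A)"])
    fix t assume t: "t \<in> {0..T}"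
    have "trunc A t \<le> (\<integral>\<^sup>+x. ennreal (exp (T * A)) \<partial>\<mu>)"
      unfolding trunc_def using t A
      by (intro nn_integral_mono ennreal_leI) (auto simp: min_le_iff_disj mult_right_mono)
    then show "trunc A t \<le> ennreal (exp (T * A))"
      using \<mu>.emeasure_space_1 by simp
    have "trunc A t \<le> 1 + (\<integral>\<^sup>+s\<in>{0..t}. ennreal (V * s) * (\<integral>\<^sup>+y. ennreal (exp (s * y)) * indicator {..A} y \<partial>uniform_multiple (square_biased V \<mu>)) \<partial>lborel)"
      using t A by (intro trunc_le_add_integral) auto
    also have "\<dots> \<le> 1 + (\<integral>\<^sup>+s. ennreal C * (trunc A s * indicator {0..t} s) \<partial>lborel)"
    proof (intro add_left_mono nn_integral_mono)
      fix s :: real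
      show "ennreal (V * s) * (\<integral>\<^sup>+y. ennreal (exp (s * y)) * indicator {..A} y \<partial>uniform_multiple (square_biased V \<mu>)) * indicator {0..t} s
        \<le> ennreal C * (trunc A s * indicator {0..t} s)"
      proof (cases "s \<in> {0..t}")
        case True
        then have s: "0 \<le> s" "s \<le> T" using t by auto
        have "1 + G s \<le> 1 + (1 + G T)" by (intro add_left_mono mgf_le_1_plus_mgf[OF \<rho>] s)
        also have "\<dots> = ennreal (2 + enn2real (G T))"
          by (subst GT) (simp add: ennreal_plus flip: ennreal_1 ennreal_plus del: ennreal_plus)
        finally have G: "1 + G s \<le> ennreal (2 + enn2real (G T))" .
        have "ennreal (V * s) * (\<integral>\<^sup>+y. ennreal (exp (s * y)) * indicator {..A} y \<partial>uniform_multiple (square_biased V \<mu>))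
           \<le> ennreal (V * s) * (trunc A s * (1 + G s))"
          by (intro mult_left_mono truncated_convolution_le s) simp
        also have "\<dots> \<le> ennreal (V * T) * (trunc A s * ennreal (2 + enn2real (G T)))"
          using s \<mu>(4) by (intro mult_mono G ennreal_leI) auto
        also have "\<dots> = ennreal C * trunc A s"
          using T \<mu>(4) by (simp add: C_def ennreal_mult mult_ac)
        finally show ?thesis using True by simp
      qed simp
    qed
    also have "\<dots> = 1 + ennreal C * (\<integral>\<^sup>+s\<in>{0..t}. trunc A s \<partial>lborel)"
      by (subst nn_integral_cmult) auto
    finally show "trunc A t \<le> 1 + ennreal C * (\<integral>\<^sup>+s\<in>{0..t}. trunc A s \<partial>lborel)" .
  qed (use T in auto)
  have "M T = (\<integral>\<^sup>+x. liminf (\<lambda>n. ennreal (min (exp (T * x)) (exp (T * real (Suc n))))) \<partial>\<mu>)"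
    unfolding mgf_def
  proof (intro nn_integral_cong sym[OF lim_imp_Liminf])
    fix x
    have "eventually (\<lambda>n. real (Suc n) \<ge> x) sequentially" by real_asymp
    then have "eventually (\<lambda>n. ennreal (min (exp (T * x)) (exp (T * real (Suc n)))) = ennreal (exp (T * x))) sequentially"
      by eventually_elim (use T in \<open>auto simp: min_def mult_left_mono\<close>)
    then show "(\<lambda>n. ennreal (min (exp (T * x)) (exp (T * real (Suc n))))) \<longlonglongrightarrow> ennreal (exp (T * x))"
      by (rule tendsto_eventually)
  qed simp
  also have "\<dots> \<le> liminf (\<lambda>n. trunc (real (Suc n)) T)"
    unfolding trunc_def by (rule nn_integral_liminf) simp
  also have "\<dots> \<le> liminf (\<lambda>n::nat. ennreal (2 * exp (2 * C * T)))"
    by (intro Liminf_mono always_eventually allI bound) simp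
  also have "\<dots> = ennreal (2 * exp (2 * C * T))" by (simp add: Liminf_const)
  finally show ?thesis by (rule le_less_trans) simp
qed

definition \<kappa> :: "real \<Rightarrow> ennreal" where
  "\<kappa> t = (\<integral>\<^sup>+s\<in>{0..t}. ennreal (V * s) * G s \<partial>lborel)"

lemma mgf_eq_exp_if_mgf_step_finite:
  assumes T: "0 < T" and fin: "G T < \<infinity>"
  shows "\<kappa> T < \<infinity> \<and> M T = ennreal (exp (enn2real (\<kappa> T)))"
proof -
  have MT: "M T < \<infinity>" by (rule mgf_finite_if_mgf_step_finite[OF assms])
  let ?m = "\<lambda>s. enn2real (M s)" and ?g = "\<lambda>s. V * s * enn2real (G s)"
  have M_fin: "M s = ennreal (?m s)" if "s \<in> {0..T}" for s
  proof -
    have "M s \<le> 1 + M T" using that by (intro mgf_le_1_plus_mgf[OF \<mu>(1)]) auto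
    also have "\<dots> < \<infinity>" using MT by simp
    finally show ?thesis by simp
  qed
  have G_fin: "G s = ennreal (enn2real (G s))" if "s \<in> {0..T}" for s
  proof -
    have "G s \<le> 1 + G T" using that by (intro mgf_le_1_plus_mgf[OF \<rho>]) auto
    also have "\<dots> < \<infinity>" using fin by simp
    finally show ?thesis by simp
  qed
  have cont: "continuous_on {0..T} ?m" "continuous_on {0..T} ?g"
    by (intro continuous_intros continuous_on_mgf \<mu> \<rho> MT fin)+
  have eq: "?m t = 1 + integral {0..t} (\<lambda>s. ?g s * ?m s)" if t: "t \<in> {0..T}" for t
  proof -
    have "ennreal (?m t) = 1 + (\<integral>\<^sup>+s\<in>{0..t}. ennreal (V * s) * (M s * G s) \<partial>lborel)"
      using volterra[of t] M_fin[OF t] t by simp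
    also have "(\<integral>\<^sup>+s\<in>{0..t}. ennreal (V * s) * (M s * G s) \<partial>lborel) = (\<integral>\<^sup>+s\<in>{0..t}. ennreal (?g s * ?m s) \<partial>lborel)"
    proof (rule nn_integral_cong)
      fix s
      show "ennreal (V * s) * (M s * G s) * indicator {0..t} s = ennreal (?g s * ?m s) * indicator {0..t} s"
        using t \<mu>(4) M_fin[of s] G_fin[of s] by (cases "s \<in> {0..t}") (auto simp: ennreal_mult mult_ac)
    qed
    also have "\<dots> = ennreal (integral {0..t} (\<lambda>s. ?g s * ?m s))"
      using t \<mu>(4) by (intro nn_integral_Icc_continuous continuous_on_subset[OF continuous_on_mult[OF cont(2,1)]]) auto
    also have "1 + \<dots> = ennreal (1 + integral {0..t} (\<lambda>s. ?g s * ?m s))"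
      using t \<mu>(4) by (subst ennreal_plus) (auto intro!: Henstock_Kurzweil_Integration.integral_nonneg integrable_continuous_interval
         continuous_on_subset[OF continuous_on_mult[OF cont(2,1)]])
    finally show ?thesis
      using t \<mu>(4) by (subst (asm) ennreal_inj) (auto intro!: add_nonneg_nonneg Henstock_Kurzweil_Integration.integral_nonneg integrable_continuous_interval
         continuous_on_subset[OF continuous_on_mult[OF cont(2,1)]])
  qed
  have sol: "?m T = exp (integral {0..T} ?g)"
    using T by (intro linear_volterra_solution[OF cont eq]) auto
  have "\<kappa> T = (\<integral>\<^sup>+s\<in>{0..T}. ennreal (?g s) \<partial>lborel)"
    unfolding \<kappa>_def
  proof (rule nn_integral_cong)
    fix s
    show "ennreal (V * s) * G s * indicator {0..T} s = ennreal (?g s) * indicator {0..T} s"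
      using \<mu>(4) G_fin[of s] by (cases "s \<in> {0..T}") (auto simp: ennreal_mult mult_ac)
  qed
  also have "\<dots> = ennreal (integral {0..T} ?g)"
    using \<mu>(4) by (intro nn_integral_Icc_continuous cont) auto
  finally have \<kappa>: "\<kappa> T = ennreal (integral {0..T} ?g)" .
  have "0 \<le> integral {0..T} ?g"
    using \<mu>(4) by (intro Henstock_Kurzweil_Integration.integral_nonneg integrable_continuous_interval cont) auto
  then show ?thesis using \<kappa> sol M_fin[of T] T by auto
qed

lemma mgf_step_finite_below:
  assumes "0 < t" "t < T" "\<kappa> T < \<infinity>"
  shows "G t < \<infinity>"
proof (rule ccontr)
  assume "\<not> G t < \<infinity>"
  have inf: "G s = \<infinity>" if "t \<le> s" for s
  proof (rule ccontr)
    assume "G s \<noteq> \<infinity>"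
    have "G t \<le> 1 + G s" using that assms(1) by (intro mgf_le_1_plus_mgf[OF \<rho>]) auto
    also have "\<dots> < \<infinity>" using \<open>G s \<noteq> \<infinity>\<close> by (simp add: less_top)
    finally show False using \<open>\<not> G t < \<infinity>\<close> by simp
  qed
  have "\<infinity> = (\<integral>\<^sup>+s. \<infinity> * indicator {t..T} s \<partial>lborel)"
    using assms by (subst nn_integral_cmult_indicator) (auto simp: ennreal_top_mult)
  also have "\<dots> \<le> \<kappa> T"
    unfolding \<kappa>_def using assms \<mu>(4) inf
    by (intro nn_integral_mono) (auto simp: indicator_def ennreal_mult_top)
  finally show False using assms by (auto simp: top_unique)
qed

text \<open>If \<open>\<kappa> T\<close> is infinite, so is \<open>M T\<close>, by the Volterra equation and \<open>M \<ge> 1\<close>. If \<open>\<kappa> T\<close> is finite, then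
\<open>G\<close> is finite on \<open>(0,T)\<close>, but possibly not at \<open>T\<close>; so the formula is proved below \<open>T\<close> and extended
by left-continuity.\<close>

lemma mgf_eq_exp_kappa:
  assumes T: "0 < T" and lim: "(\<lambda>n. \<kappa> (T * (1 - 1 / real (n + 2)))) \<longlonglongrightarrow> \<kappa> T"
  shows "M T = (if \<kappa> T = \<infinity> then \<infinity> else ennreal (exp (enn2real (\<kappa> T))))"
proof (cases "\<kappa> T = \<infinity>")
  case True
  have "M T = \<infinity>"
  proof (rule ccontr)
    assume "M T \<noteq> \<infinity>"
    have "\<kappa> T \<le> (\<integral>\<^sup>+s\<in>{0..T}. ennreal (V * s) * (M s * G s) \<partial>lborel)"
      unfolding \<kappa>_def
    proof (intro nn_integral_mono)
      fix s :: real
      have "1 * G s \<le> M s * G s" if "0 \<le> s" using volterra[OF that] by (intro mult_right_mono) auto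
      then show "ennreal (V * s) * G s * indicator {0..T} s \<le> ennreal (V * s) * (M s * G s) * indicator {0..T} s"
        by (auto simp: indicator_def intro!: mult_left_mono)
    qed
    also have "\<dots> \<le> M T" using volterra[of T] T by simp
    finally show False using True \<open>M T \<noteq> \<infinity>\<close> by (simp add: top_unique)
  qed
  then show ?thesis using True by simp
next
  case False
  define t where "t n = T * (1 - 1 / real (n + 2))" for n
  have t: "0 < t n" "t n < T" for n
    using T by (auto simp: t_def intro!: mult_pos_pos)
  have eq: "M (t n) = ennreal (exp (enn2real (\<kappa> (t n))))" for n
    using mgf_eq_exp_if_mgf_step_finite[OF t(1)[of n] mgf_step_finite_below[OF t[of n]]] False
    by (auto simp: less_top)
  have "(\<lambda>n. M (t n)) \<longlonglongrightarrow> M T"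
    unfolding t_def by (rule mgf_left_limit[OF \<mu>(1) T])
  moreover have "(\<lambda>n. M (t n)) \<longlonglongrightarrow> ennreal (exp (enn2real (\<kappa> T)))"
    unfolding eq using False lim by (intro tendsto_ennrealI tendsto_exp tendsto_enn2real) (auto simp: t_def less_top)
  ultimately show ?thesis using False LIMSEQ_unique by auto
qed

end

section \<open>The cumulant as a moment generating function\<close>

text \<open>The factor \<open>s\<close> turns the average of \<open>exp (r z)\<close> over \<open>r \<in> (0,s)\<close> into an integral, and the iterated
integral over \<open>0 < r < s < t\<close> is an integral over \<open>r\<close> with weight \<open>t - r\<close>, that is, a Beta(1,2) average.
Both sides are evaluated in closed form.\<close>

lemma beta_exp_kernel:
  fixes t z :: real
  assumes t: "0 < t"
  shows "ennreal (t\<^sup>2 / 2) * (\<integral>\<^sup>+b. (ennreal (2 * (1 - b)) * indicator {0<..<1} b) * ennreal (exp (t * (b * z))) \<partial>lborel) =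
    (\<integral>\<^sup>+s\<in>{0..t}. ennreal s * (\<integral>\<^sup>+u. ennreal (exp (s * (u * z))) \<partial>unif) \<partial>lborel)"
proof -
  have "ennreal (t\<^sup>2 / 2) * (\<integral>\<^sup>+b. (ennreal (2 * (1 - b)) * indicator {0<..<1} b) * ennreal (exp (t * (b * z))) \<partial>lborel)
    = (\<integral>\<^sup>+b. ennreal (t\<^sup>2 / 2) * ((ennreal (2 * (1 - b)) * indicator {0<..<1} b) * ennreal (exp (t * (b * z)))) \<partial>lborel)"
    by (rule nn_integral_cmult[symmetric]) simp
  also have "\<dots> = (\<integral>\<^sup>+b. ennreal (t\<^sup>2 * (1 - b) * exp (t * (b * z))) * indicator {0..1} b \<partial>unif)"
  proof -
    \<comment> \<open>The integrands also agree at \<open>b = 1\<close>, where the density vanishes.\<close>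
    have "AE b in lborel. b \<noteq> (0::real)" by (rule AE_lborel_singleton)
    then have "AE b in lborel. ennreal (t\<^sup>2 / 2) * ((ennreal (2 * (1 - b)) * indicator {0<..<1} b) * ennreal (exp (t * (b * z))))
      = ennreal (t\<^sup>2 * (1 - b) * exp (t * (b * z))) * indicator {0..1} b"
    proof eventually_elim
      case (elim b)
      have "ennreal (t\<^sup>2 / 2) * (ennreal (2 * (1 - b)) * ennreal (exp (t * (b * z)))) = ennreal (t\<^sup>2 * (1 - b) * exp (t * (b * z)))"
        if "b \<le> 1"
        using that by (simp add: ennreal_mult[symmetric] mult.assoc)
      then show ?case using elim by (cases "b = 1") (auto simp: indicator_def)
    qed
    from nn_integral_cong_AE[OF this] show ?thesis
      by (subst nn_integral_unif) (auto simp: indicator_def mult_ac intro!: nn_integral_cong)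
  qed
  finally have lhs: "ennreal (t\<^sup>2 / 2) * (\<integral>\<^sup>+b. (ennreal (2 * (1 - b)) * indicator {0<..<1} b) * ennreal (exp (t * (b * z))) \<partial>lborel)
    = (\<integral>\<^sup>+b\<in>{0..1}. ennreal (t\<^sup>2 * (1 - b) * exp (t * (b * z))) \<partial>lborel)"
    by (subst (asm) nn_integral_unif) (auto simp: indicator_def mult_ac intro!: nn_integral_cong)
  have inner: "ennreal s * (\<integral>\<^sup>+u. ennreal (exp (s * (u * z))) \<partial>unif) = (\<integral>\<^sup>+u. ennreal (s * exp (s * (u * z))) \<partial>unif)"
    if "0 \<le> s" for s
    using that by (subst nn_integral_cmult[symmetric]) (auto simp: ennreal_mult)
  show ?thesis
  proof (cases "z = 0")
    case True
    have "(\<integral>\<^sup>+b\<in>{0..1}. ennreal (t\<^sup>2 * (1 - b) * exp (t * (b * z))) \<partial>lborel) = ennreal (t\<^sup>2 * (1 - 1\<^sup>2 / 2) - t\<^sup>2 * (0 - 0\<^sup>2 / 2))"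
      by (rule nn_integral_FTC_Icc[where F="\<lambda>b. t\<^sup>2 * (b - b\<^sup>2 / 2)"])
        (use True in \<open>auto intro!: derivative_eq_intros mult_left_le simp: right_diff_distrib\<close>)
    moreover have "(\<integral>\<^sup>+s\<in>{0..t}. ennreal s * (\<integral>\<^sup>+u. ennreal (exp (s * (u * z))) \<partial>unif) \<partial>lborel) = (\<integral>\<^sup>+s\<in>{0..t}. ennreal s \<partial>lborel)"
      using True unif.emeasure_space_1 by simp
    moreover have "(\<integral>\<^sup>+s\<in>{0..t}. ennreal s \<partial>lborel) = ennreal (t\<^sup>2 / 2 - 0\<^sup>2 / 2)"
      by (rule nn_integral_FTC_Icc[where F="\<lambda>s. s\<^sup>2 / 2"]) (use t in \<open>auto intro!: derivative_eq_intros\<close>)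
    ultimately show ?thesis using lhs by simp
  next
    case False
    let ?c = "(exp (t * z) - 1 - t * z) / z\<^sup>2"
    have "(\<integral>\<^sup>+b\<in>{0..1}. ennreal (t\<^sup>2 * (1 - b) * exp (t * (b * z))) \<partial>lborel) =
       ennreal ((t * (1 - 1) * exp (t * (1 * z)) / z + exp (t * (1 * z)) / z\<^sup>2) - (t * (1 - 0) * exp (t * (0 * z)) / z + exp (t * (0 * z)) / z\<^sup>2))"
    proof (rule nn_integral_FTC_Icc[where F="\<lambda>b. t * (1 - b) * exp (t * (b * z)) / z + exp (t * (b * z)) / z\<^sup>2"])
      show "((\<lambda>b. t * (1 - b) * exp (t * (b * z)) / z + exp (t * (b * z)) / z\<^sup>2) has_real_derivative
          t\<^sup>2 * (1 - b) * exp (t * (b * z))) (at b)" for b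
        using False by (auto intro!: derivative_eq_intros simp: field_simps power2_eq_square)
    qed auto
    also have "\<dots> = ennreal ?c" using False by (simp add: field_simps power2_eq_square)
    finally have 1: "(\<integral>\<^sup>+b\<in>{0..1}. ennreal (t\<^sup>2 * (1 - b) * exp (t * (b * z))) \<partial>lborel) = ennreal ?c" .
    have inner': "(\<integral>\<^sup>+u. ennreal (s * exp (s * (u * z))) \<partial>unif) = ennreal (z * (exp (s * z) - 1) / z\<^sup>2)" if s: "0 \<le> s" for s
    proof -
      have "(\<integral>\<^sup>+u. ennreal (s * exp (s * (u * z))) \<partial>unif) = ennreal (exp (s * (1 * z)) / z - exp (s * (0 * z)) / z)"
        using s False by (intro nn_integral_unif_FTC) (auto intro!: derivative_eq_intros)
      also have "exp (s * (1 * z)) / z - exp (s * (0 * z)) / z = z * (exp (s * z) - 1) / z\<^sup>2"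
        using False by (simp add: field_simps power2_eq_square)
      finally show ?thesis .
    qed
    have "(\<integral>\<^sup>+s\<in>{0..t}. ennreal s * (\<integral>\<^sup>+u. ennreal (exp (s * (u * z))) \<partial>unif) \<partial>lborel)
       = (\<integral>\<^sup>+s. ennreal (1 / z\<^sup>2) * (ennreal (z * (exp (s * z) - 1)) * indicator {0..t} s) \<partial>lborel)"
      using mult_exp_minus_1_nonneg[of _ z]
      by (intro nn_integral_cong) (auto simp: inner inner' indicator_def ennreal_mult[symmetric])
    also have "\<dots> = ennreal (1 / z\<^sup>2) * (\<integral>\<^sup>+s\<in>{0..t}. ennreal (z * (exp (s * z) - 1)) \<partial>lborel)"
      by (rule nn_integral_cmult) simp
    also have "\<dots> = ennreal ?c"
      using t by (simp add: exp_moment_kernel_outer ennreal_mult[symmetric] le_exp_minus_1)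
    finally show ?thesis using lhs 1 by simp
  qed
qed

lemma mgf_beta_times:
  assumes N: "prob_space N" and Z: "Z \<in> borel_measurable N"
    and B: "distributed N lborel B f" and [measurable]: "f \<in> borel_measurable borel"
    and indep: "prob_space.indep_var N borel B borel Z"
  shows "mgf N (\<lambda>\<omega>. B \<omega> * Z \<omega>) t =
    (\<integral>\<^sup>+z. \<integral>\<^sup>+b. f b * ennreal (exp (t * (b * z))) \<partial>lborel \<partial>distr N borel Z)"
proof -
  interpret N: prob_space N by fact
  note [measurable] = Z
  have [measurable]: "B \<in> borel_measurable N" using B by (auto simp: distributed_def)
  interpret Z: prob_space "distr N borel Z" by (rule N.prob_space_distr) simp
  interpret B: prob_space "distr N borel B" by (rule N.prob_space_distr) simp
  interpret P: pair_sigma_finite "distr N borel B" "distr N borel Z" ..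
  have dB: "distr N borel B = density lborel f"
    using B by (simp add: distributed_def cong: distr_cong)
  have "mgf N (\<lambda>\<omega>. B \<omega> * Z \<omega>) t = (\<integral>\<^sup>+p. ennreal (exp (t * (fst p * snd p))) \<partial>distr N (borel \<Otimes>\<^sub>M borel) (\<lambda>\<omega>. (B \<omega>, Z \<omega>)))"
    unfolding mgf_def by (subst nn_integral_distr) auto
  also have "\<dots> = (\<integral>\<^sup>+p. ennreal (exp (t * (fst p * snd p))) \<partial>(distr N borel B \<Otimes>\<^sub>M distr N borel Z))"
    using indep by (simp add: N.indep_var_distribution_eq)
  also have "\<dots> = (\<integral>\<^sup>+z. \<integral>\<^sup>+b. ennreal (exp (t * (b * z))) \<partial>distr N borel B \<partial>distr N borel Z)"
    by (subst P.nn_integral_snd[symmetric]) auto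
  also have "\<dots> = (\<integral>\<^sup>+z. \<integral>\<^sup>+b. f b * ennreal (exp (t * (b * z))) \<partial>lborel \<partial>distr N borel Z)"
    unfolding dB by (simp add: nn_integral_density)
  finally show ?thesis .
qed

text \<open>The cumulant is \<open>\<kappa> t = V \<integral>s E exp (s U Z) ds\<close>, integrated over \<open>(0,t)\<close>, and the Beta kernel rewrites
this as \<open>V t\<^sup>2 / 2 E exp (t B Z)\<close>. This form also shows that \<open>\<kappa>\<close> is left-continuous as a function with
values in \<open>[0,\<infinity>]\<close>.\<close>

lemma cumulant_eq_mgf_beta_multiple:
  fixes M :: "'a measure" and X :: "'a \<Rightarrow> real" and N :: "'b measure" and Z B :: "'b \<Rightarrow> real"
  assumes M: "prob_space M" and X: "X \<in> borel_measurable M"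
    and LK: "levy_triplet (distr M borel X) b a \<nu>"
    and fin_var: "integrable M X" "integrable M (\<lambda>\<omega>. (X \<omega>)\<^sup>2)"
    and centered: "prob_space.expectation M X = 0"
    and V: "V = prob_space.variance M X" "0 < V"
    and N: "prob_space N"
    and Z: "Z \<in> borel_measurable N"
      "distr N borel Z = scale_measure (ennreal (1 / V)) (kolmogorov_measure a \<nu>)"
    and B: "distributed N lborel B (\<lambda>b. ennreal (2 * (1 - b)) * indicator {0<..<1} b)"
    and indep: "prob_space.indep_var N borel B borel Z"
    and t: "0 < t"
  shows "cumulant M X t = enn2ereal (ennreal (V * t\<^sup>2 / 2) * mgf N (\<lambda>\<omega>. B \<omega> * Z \<omega>) t)"
proof -
  interpret M: prob_space M by fact
  interpret N: prob_space N by fact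
  note [measurable] = X Z(1)
  define \<mu> where "\<mu> = distr M borel X"
  define \<pi> where "\<pi> = distr N borel Z"
  have \<mu>: "real_distribution \<mu>" unfolding \<mu>_def by (rule M.real_distribution_distr) simp
  have \<pi>: "real_distribution \<pi>" unfolding \<pi>_def by (rule N.real_distribution_distr) simp
  interpret \<pi>: real_distribution \<pi> by (fact \<pi>)
  have sq: "integrable \<mu> (\<lambda>x. x\<^sup>2)" "(\<integral>x. x\<^sup>2 \<partial>\<mu>) = V" and mean: "integrable \<mu> (\<lambda>x. x)" "(\<integral>x. x \<partial>\<mu>) = 0"
    using fin_var centered V(1) by (simp_all add: \<mu>_def integrable_distr_eq integral_distr)
  define \<rho> where "\<rho> = uniform_multiple \<pi>"
  interpret zero_bias_identity \<mu> \<rho> V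
  proof (rule zero_bias_identity.intro)
    show "uniform_multiple (square_biased V \<mu>) = distr (\<mu> \<Otimes>\<^sub>M \<rho>) borel (\<lambda>(x, y). x + y)"
      unfolding \<rho>_def
      by (rule uniform_multiple_square_biased_eq_convolution[OF \<mu> sq V(2) mean LK[folded \<mu>_def] Z(2)[folded \<pi>_def] \<pi>])
    show "real_distribution \<rho>" unfolding \<rho>_def by (rule real_distribution_uniform_multiple[OF \<pi>])
  qed fact+
  interpret P: pair_sigma_finite lborel \<pi> ..
  let ?mR = "mgf N (\<lambda>\<omega>. B \<omega> * Z \<omega>)"
  have \<kappa>: "\<kappa> t = ennreal (V * t\<^sup>2 / 2) * ?mR t" if t: "0 < t" for t
  proof -
    have "\<kappa> t = (\<integral>\<^sup>+s. \<integral>\<^sup>+z. ennreal V * (ennreal s * (\<integral>\<^sup>+u. ennreal (exp (s * (u * z))) \<partial>unif) * indicator {0..t} s) \<partial>\<pi> \<partial>lborel)"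
      unfolding \<kappa>_def
    proof (rule nn_integral_cong)
      fix s
      show "ennreal (V * s) * G s * indicator {0..t} s =
        (\<integral>\<^sup>+z. ennreal V * (ennreal s * (\<integral>\<^sup>+u. ennreal (exp (s * (u * z))) \<partial>unif) * indicator {0..t} s) \<partial>\<pi>)"
      proof (cases "s \<in> {0..t}")
        case True
        have "G s = (\<integral>\<^sup>+z. \<integral>\<^sup>+u. ennreal (exp (s * (u * z))) \<partial>unif \<partial>\<pi>)"
          unfolding \<rho>_def mgf_def by (rule nn_integral_uniform_multiple[OF \<pi>]) simp
        then show ?thesis using True V(2) by (simp add: nn_integral_cmult ennreal_mult mult.assoc)
      qed simp
    qed
    also have "\<dots> = (\<integral>\<^sup>+z. \<integral>\<^sup>+s. ennreal V * (ennreal s * (\<integral>\<^sup>+u. ennreal (exp (s * (u * z))) \<partial>unif) * indicator {0..t} s) \<partial>lborel \<partial>\<pi>)"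
      by (rule P.Fubini'[symmetric]) simp
    also have "\<dots> = (\<integral>\<^sup>+z. ennreal (V * t\<^sup>2 / 2) * (\<integral>\<^sup>+b. (ennreal (2 * (1 - b)) * indicator {0<..<1} b) * ennreal (exp (t * (b * z))) \<partial>lborel) \<partial>\<pi>)"
    proof (rule nn_integral_cong)
      fix z
      have "(\<integral>\<^sup>+s. ennreal V * (ennreal s * (\<integral>\<^sup>+u. ennreal (exp (s * (u * z))) \<partial>unif) * indicator {0..t} s) \<partial>lborel)
        = ennreal V * (\<integral>\<^sup>+s\<in>{0..t}. ennreal s * (\<integral>\<^sup>+u. ennreal (exp (s * (u * z))) \<partial>unif) \<partial>lborel)"
        by (rule nn_integral_cmult) simp
      also have "\<dots> = ennreal V * (ennreal (t\<^sup>2 / 2) * (\<integral>\<^sup>+b. (ennreal (2 * (1 - b)) * indicator {0<..<1} b) * ennreal (exp (t * (b * z))) \<partial>lborel))"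
        by (simp only: beta_exp_kernel[OF t])
      also have "\<dots> = ennreal (V * t\<^sup>2 / 2) * (\<integral>\<^sup>+b. (ennreal (2 * (1 - b)) * indicator {0<..<1} b) * ennreal (exp (t * (b * z))) \<partial>lborel)"
        using V(2) by (simp add: mult.assoc[symmetric] ennreal_mult[symmetric])
      finally show "(\<integral>\<^sup>+s. ennreal V * (ennreal s * (\<integral>\<^sup>+u. ennreal (exp (s * (u * z))) \<partial>unif) * indicator {0..t} s) \<partial>lborel)
         = ennreal (V * t\<^sup>2 / 2) * (\<integral>\<^sup>+b. (ennreal (2 * (1 - b)) * indicator {0<..<1} b) * ennreal (exp (t * (b * z))) \<partial>lborel)" .
    qed
    also have "\<dots> = ennreal (V * t\<^sup>2 / 2) * ?mR t"
      by (subst mgf_beta_times[OF N Z(1) B _ indep]) (auto simp: \<pi>_def[symmetric] nn_integral_cmult)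
    finally show ?thesis .
  qed
  have [measurable]: "B \<in> borel_measurable N" using B by (auto simp: distributed_def)
  define R where "R = distr N borel (\<lambda>\<omega>. B \<omega> * Z \<omega>)"
  have R: "real_distribution R" unfolding R_def by (rule N.real_distribution_distr) simp
  have mR: "?mR s = mgf R (\<lambda>x. x) s" for s
    unfolding R_def mgf_def by (subst nn_integral_distr) auto
  have mR_pos: "?mR t \<noteq> 0"
    unfolding mgf_def by (subst nn_integral_0_iff_AE) (auto simp: N.AE_False)
  define r where "r n = 1 - 1 / real (n + 2)" for n
  have r: "0 < r n" for n by (auto simp: r_def)
  have r_lim: "r \<longlonglongrightarrow> 1" unfolding r_def by real_asymp
  have "(\<lambda>n. ennreal (V * (t * r n)\<^sup>2 / 2) * ?mR (t * r n)) \<longlonglongrightarrow> ennreal (V * (t * 1)\<^sup>2 / 2) * ?mR t"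
  proof (rule tendsto_mult_ennreal)
    show "(\<lambda>n. ?mR (t * r n)) \<longlonglongrightarrow> ?mR t"
      using mgf_left_limit[OF R t] by (simp add: mR r_def)
    show "(\<lambda>n. ennreal (V * (t * r n)\<^sup>2 / 2)) \<longlonglongrightarrow> ennreal (V * (t * 1)\<^sup>2 / 2)"
      by (intro tendsto_ennrealI tendsto_intros r_lim) simp
  qed (use mR_pos t V(2) in auto)
  then have "(\<lambda>n. \<kappa> (t * r n)) \<longlonglongrightarrow> \<kappa> t"
    using t r by (simp add: \<kappa>)
  then have eq: "mgf \<mu> (\<lambda>x. x) t = (if \<kappa> t = \<infinity> then \<infinity> else ennreal (exp (enn2real (\<kappa> t))))"
    unfolding r_def by (rule mgf_eq_exp_kappa[OF t])
  have "mgf M X t = mgf \<mu> (\<lambda>x. x) t"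
    unfolding \<mu>_def mgf_def by (subst nn_integral_distr) auto
  then have "cumulant M X t = enn2ereal (\<kappa> t)"
    unfolding cumulant_def using eq by (cases "\<kappa> t") (auto simp: enn2ereal_ennreal)
  then show ?thesis by (simp add: \<kappa> t)
qed

section \<open>The optimal scale parameter\<close>

lemma feasible_iff_mgf_le:
  assumes K: "\<And>t. 0 < t \<Longrightarrow> cumulant M X t = enn2ereal (ennreal (V * t\<^sup>2 / 2) * m t)"
    and M: "prob_space M" and "0 < V" "0 < \<theta>" "0 \<le> c"
  shows "feasible M X (\<theta> * V) c \<longleftrightarrow> (\<forall>t>0. c = 0 \<or> t < 1 / c \<longrightarrow> m t \<le> ennreal (\<theta> / (1 - c * t)))"
proof -
  interpret prob_space M by fact
  have K0: "cumulant M X 0 = 0" using emeasure_space_1 by (simp add: cumulant_def mgf_def)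
  have ct: "0 < 1 - c * t" if "c = 0 \<or> t < 1 / c" for t
    using that \<open>0 \<le> c\<close> by (cases "c = 0") (auto simp: field_simps)
  have le_iff: "cumulant M X t \<le> ereal (\<theta> * V * t\<^sup>2 / (2 * (1 - c * t))) \<longleftrightarrow> m t \<le> ennreal (\<theta> / (1 - c * t))"
    if t: "0 < t" and c: "c = 0 \<or> t < 1 / c" for t
  proof -
    define q where "q = \<theta> / (1 - c * t)"
    have q: "0 < q" using ct[OF c] assms by (simp add: q_def)
    define p where "p = V * t\<^sup>2 / 2"
    have p: "0 < p" using assms t by (simp add: p_def)
    have "\<theta> * V * t\<^sup>2 / (2 * (1 - c * t)) = p * q" using ct[OF c] by (simp add: p_def q_def field_simps)
    then have "cumulant M X t \<le> ereal (\<theta> * V * t\<^sup>2 / (2 * (1 - c * t))) \<longleftrightarrow> enn2ereal (ennreal p * m t) \<le> enn2ereal (ennreal (p * q))"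
      using p q t by (simp add: K p_def[symmetric] enn2ereal_ennreal)
    also have "\<dots> \<longleftrightarrow> ennreal p * m t \<le> ennreal (p * q)" by (simp add: less_eq_ennreal.rep_eq)
    also have "\<dots> \<longleftrightarrow> m t \<le> ennreal q"
      using p q by (cases "m t") (auto simp: ennreal_mult[symmetric] ennreal_mult_top top_unique)
    finally show ?thesis by (simp add: q_def)
  qed
  have "feasible M X (\<theta> * V) c \<longleftrightarrow>
     (\<forall>t>0. c = 0 \<or> t < 1 / c \<longrightarrow> cumulant M X t \<le> ereal (\<theta> * V * t\<^sup>2 / (2 * (1 - c * t))))"
    using assms unfolding feasible_def by (auto simp: K0 order_le_less[of "0::real"])
  then show ?thesis using le_iff by blast
qed

lemma mgf_le_below_t_level:
  assumes "0 < t" "ennreal t < t_level N R \<theta>"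
  shows "mgf N R t \<le> ennreal \<theta>"
proof (rule ccontr)
  assume "\<not> mgf N R t \<le> ennreal \<theta>"
  then have "t_level N R \<theta> \<le> ennreal t"
    unfolding t_level_def using assms(1) by (intro Inf_lower) auto
  with assms(2) show False by simp
qed

text \<open>Below \<open>\<tau> = t_level N R \<theta>\<close> the moment generating function is at most \<open>\<theta> \<le> \<theta> / (1 - t / \<tau>)\<close>, so the
scale \<open>1 / \<tau>\<close> is feasible.\<close>

lemma c_star_le:
  assumes feas: "\<And>c. 0 \<le> c \<Longrightarrow> feasible M X v c \<longleftrightarrow> (\<forall>t>0. c = 0 \<or> t < 1 / c \<longrightarrow> mgf N R t \<le> ennreal (\<theta> / (1 - c * t)))"
    and \<theta>: "1 \<le> \<theta>"
  shows "c_star M X v \<le> 1 / t_level N R \<theta>"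
proof (cases "t_level N R \<theta>")
  case top
  then have "feasible M X v 0" by (subst feas) (auto intro!: mgf_le_below_t_level)
  then have "c_star M X v \<le> ennreal 0" unfolding c_star_def by (intro Inf_lower) (auto intro!: exI[of _ 0])
  then show ?thesis by simp
next
  case (real \<tau>)
  show ?thesis
  proof (cases "\<tau> = 0")
    case False
    then have \<tau>: "0 < \<tau>" using real by simp
    have "feasible M X v (1 / \<tau>)"
    proof (subst feas, safe)
      fix t :: real assume t: "0 < t" and "t < 1 / (1 / \<tau>)"
      then have "t < \<tau>" by simp
      then have "mgf N R t \<le> ennreal \<theta>" using t real by (intro mgf_le_below_t_level) (auto simp: ennreal_lessI)
      also have "\<dots> \<le> ennreal (\<theta> / (1 - 1 / \<tau> * t))"
        using t \<open>t < \<tau>\<close> \<theta> \<tau> by (intro ennreal_leI) (auto simp: field_simps)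
      finally show "mgf N R t \<le> ennreal (\<theta> / (1 - 1 / \<tau> * t))" .
    qed (use \<tau> in auto)
    then have "c_star M X v \<le> ennreal (1 / \<tau>)" unfolding c_star_def using \<tau> by (intro Inf_lower) auto
    also have "\<dots> = 1 / t_level N R \<theta>" using real \<tau> by (simp add: divide_ennreal flip: ennreal_1)
    finally show ?thesis .
  qed (use real in simp)
qed

text \<open>If \<open>c\<close> is feasible and \<open>c t \<le> 1 - 1 / l\<close>, then \<open>\<theta> / (1 - c t) \<le> l \<theta>\<close>. So the level \<open>l \<theta>\<close> is not
exceeded before \<open>(1 - 1 / l) / c\<close>.\<close>

lemma c_star_ge:
  assumes feas: "\<And>c. 0 \<le> c \<Longrightarrow> feasible M X v c \<longleftrightarrow> (\<forall>t>0. c = 0 \<or> t < 1 / c \<longrightarrow> mgf N R t \<le> ennreal (\<theta> / (1 - c * t)))"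
    and \<theta>: "1 \<le> \<theta>" and l: "1 < l"
  shows "ennreal (1 - 1 / l) * (1 / t_level N R (l * \<theta>)) \<le> c_star M X v"
  unfolding c_star_def
proof (rule Inf_greatest, safe)
  fix c :: real assume c: "0 \<le> c" "feasible M X v c"
  define p where "p = 1 - 1 / l"
  have p: "0 < p" "p < 1" using l by (auto simp: p_def)
  have m: "mgf N R t \<le> ennreal (l * \<theta>)" if t: "0 < t" "c * t \<le> p" for t
  proof -
    have ct: "1 / l \<le> 1 - c * t" "0 < 1 - c * t" using t p by (simp_all add: p_def[symmetric]) (simp add: p_def)
    have "c = 0 \<or> t < 1 / c" using ct c by (cases "c = 0") (auto simp: field_simps)
    then have "mgf N R t \<le> ennreal (\<theta> / (1 - c * t))" using c t feas by blast
    also have "\<dots> \<le> ennreal (\<theta> / (1 / l))"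
      using ct \<theta> l by (intro ennreal_leI divide_left_mono) auto
    finally show ?thesis by (simp add: mult.commute)
  qed
  show "ennreal (1 - 1 / l) * (1 / t_level N R (l * \<theta>)) \<le> ennreal c"
  proof (cases "c = 0")
    case True
    have empty: "{ennreal t |t. 0 < t \<and> mgf N R t > ennreal (l * \<theta>)} = {}"
      using m True p by (auto simp: not_less[symmetric])
    have "t_level N R (l * \<theta>) = top" unfolding t_level_def empty by simp
    then show ?thesis by simp
  next
    case False
    with c have c0: "0 < c" by simp
    have "ennreal (p / c) \<le> t_level N R (l * \<theta>)"
      unfolding t_level_def
    proof (rule Inf_greatest, safe)
      fix t :: real assume t: "0 < t" "ennreal (l * \<theta>) < mgf N R t"
      have "\<not> c * t \<le> p" using m t by (auto simp: not_less[symmetric])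
      then show "ennreal (p / c) \<le> ennreal t" using c0 by (intro ennreal_leI) (simp add: field_simps)
    qed
    then have "1 / t_level N R (l * \<theta>) \<le> 1 / ennreal (p / c)"
    proof (cases "t_level N R (l * \<theta>)")
      case (real r)
      with \<open>ennreal (p / c) \<le> _\<close> have r: "p / c \<le> r" by simp
      moreover have "0 < p / c" using p c0 by simp
      ultimately have "0 < r" by linarith
      then show ?thesis
        using r p c0 real by (simp add: divide_ennreal field_simps flip: ennreal_1)
    qed simp
    then have "ennreal p * (1 / t_level N R (l * \<theta>)) \<le> ennreal p * (1 / ennreal (p / c))"
      by (intro mult_left_mono) auto
    also have "\<dots> = ennreal c"
      using p c0 by (simp add: divide_ennreal ennreal_mult[symmetric] flip: ennreal_1)
    finally show ?thesis by (simp add: p_def)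
  qed
qed

lemma tendsto_1_by_sandwich:
  fixes c T :: "real \<Rightarrow> ennreal"
  assumes up: "\<And>\<theta>. 1 \<le> \<theta> \<Longrightarrow> c \<theta> \<le> 1 / T \<theta>"
    and low: "\<And>\<theta> l. 1 \<le> \<theta> \<Longrightarrow> 1 < l \<Longrightarrow> ennreal (1 - 1 / l) * (1 / T (l * \<theta>)) \<le> c \<theta>"
    and fin: "\<forall>\<^sub>F \<theta> in at_top. 0 < T \<theta> \<and> T \<theta> < \<infinity>"
    and slow: "\<And>l. 1 < l \<Longrightarrow> ((\<lambda>\<theta>. T (l * \<theta>) / T \<theta>) \<longlongrightarrow> 1) at_top"
  shows "((\<lambda>\<theta>. c \<theta> * T \<theta>) \<longlongrightarrow> 1) at_top"
proof (rule order_tendstoI)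
  fix a :: ennreal assume a: "a < 1"
  then obtain \<alpha> where \<alpha>: "a = ennreal \<alpha>" "0 \<le> \<alpha>" "\<alpha> < 1" by (cases a) auto
  \<comment> \<open>With this choice \<open>1 - 1 / l\<close> is the midpoint of \<open>\<alpha>\<close> and \<open>1\<close>.\<close>
  define l where "l = 2 / (1 - \<alpha>)"
  have l: "1 < l" "1 - 1 / l = (1 + \<alpha>) / 2" using \<alpha> by (auto simp: l_def field_simps)
  have "((\<lambda>\<theta>. ennreal (1 - 1 / l) * (1 / (T (l * \<theta>) / T \<theta>))) \<longlongrightarrow> ennreal (1 - 1 / l) * (1 / 1)) at_top"
    unfolding divide_ennreal_def[of 1] mult_1
    by (intro ennreal_tendsto_cmult continuous_on_tendsto_compose[OF continuous_on_inverse_ennreal[OF continuous_on_id[of UNIV]]] slow l) auto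
  moreover have "a < ennreal (1 - 1 / l) * (1 / 1)"
    using \<alpha> by (simp add: l(2) ennreal_less_iff)
  ultimately have "\<forall>\<^sub>F \<theta> in at_top. a < ennreal (1 - 1 / l) * (1 / (T (l * \<theta>) / T \<theta>))"
    by (rule order_tendstoD(1))
  then show "\<forall>\<^sub>F \<theta> in at_top. a < c \<theta> * T \<theta>"
    using fin eventually_ge_at_top[of 1]
  proof eventually_elim
    case (elim \<theta>)
    have "1 / (T (l * \<theta>) / T \<theta>) = 1 / T (l * \<theta>) * T \<theta>"
    proof (cases "T (l * \<theta>)")
      case top
      then show ?thesis using elim by (auto simp: ennreal_top_divide)
    next
      case (real r)
      then show ?thesis using elim
        by (cases "T \<theta>"; cases "r = 0") (auto simp: divide_ennreal ennreal_mult[symmetric] ennreal_top_mult simp flip: ennreal_1)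
    qed
    then have "a < ennreal (1 - 1 / l) * (1 / T (l * \<theta>)) * T \<theta>" using elim(1) by (simp add: mult.assoc)
    also have "\<dots> \<le> c \<theta> * T \<theta>" using low[OF elim(3) l(1)] by (rule mult_right_mono) simp
    finally show ?case .
  qed
next
  fix a :: ennreal assume a: "1 < a"
  show "\<forall>\<^sub>F \<theta> in at_top. c \<theta> * T \<theta> < a"
    using fin eventually_ge_at_top[of 1]
  proof eventually_elim
    case (elim \<theta>)
    have "c \<theta> * T \<theta> \<le> 1 / T \<theta> * T \<theta>" using up[OF elim(2)] by (rule mult_right_mono) simp
    also have "\<dots> \<le> 1"
      using elim by (cases "T \<theta>") (auto simp: divide_ennreal ennreal_mult[symmetric] simp flip: ennreal_1)
    finally show ?case using a by (rule le_less_trans)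
  qed
qed

theorem theorem5p5:
  fixes M :: "'a measure" and X :: "'a \<Rightarrow> real" and V a :: real and \<nu> :: "real measure"
    and N :: "'b measure" and Z B R :: "'b \<Rightarrow> real"
  assumes M: "prob_space M" and X: "X \<in> borel_measurable M"
    and inf_div: "infinitely_divisible (distr M borel X)"
    and char_pair: "\<exists>b. levy_triplet (distr M borel X) b a \<nu>"
    and fin_var: "integrable M X" "integrable M (\<lambda>\<omega>. (X \<omega>)\<^sup>2)"
    and centered: "prob_space.expectation M X = 0"
    and V: "V = prob_space.variance M X" "0 < V"
    and N: "prob_space N"
    and Z: "Z \<in> borel_measurable N"
      "distr N borel Z = scale_measure (ennreal (1 / V)) (kolmogorov_measure a \<nu>)"
    and B: "distributed N lborel B (\<lambda>b. ennreal (2 * (1 - b)) * indicator {0<..<1} b)"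
    and indep: "prob_space.indep_var N borel B borel Z"
    and R: "R = (\<lambda>\<omega>. B \<omega> * Z \<omega>)"
  shows "(\<forall>\<theta>\<ge>1. \<forall>l>1.
            ennreal (1 - 1 / l) * (1 / t_level N R (l * \<theta>)) \<le> c_star M X (\<theta> * V) \<and>
            c_star M X (\<theta> * V) \<le> 1 / t_level N R \<theta>) \<and>
         ((\<forall>\<^sub>F \<theta> in at_top. 0 < t_level N R \<theta> \<and> t_level N R \<theta> < \<infinity>) \<and>
          (\<forall>l>1. ((\<lambda>\<theta>. t_level N R (l * \<theta>) / t_level N R \<theta>) \<longlongrightarrow> 1) at_top)
          \<longrightarrow> ((\<lambda>\<theta>. c_star M X (\<theta> * V) * t_level N R \<theta>) \<longlongrightarrow> 1) at_top)"
proof -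
  obtain b where LK: "levy_triplet (distr M borel X) b a \<nu>" using char_pair by blast
  have K: "cumulant M X t = enn2ereal (ennreal (V * t\<^sup>2 / 2) * mgf N R t)" if "0 < t" for t
    unfolding R by (rule cumulant_eq_mgf_beta_multiple[OF M X LK fin_var centered V N Z B indep that])
  have feas: "feasible M X (\<theta> * V) c \<longleftrightarrow> (\<forall>t>0. c = 0 \<or> t < 1 / c \<longrightarrow> mgf N R t \<le> ennreal (\<theta> / (1 - c * t)))"
    if "1 \<le> \<theta>" "0 \<le> c" for \<theta> c
    using that V(2) by (intro feasible_iff_mgf_le[OF K M]) auto
  have up: "c_star M X (\<theta> * V) \<le> 1 / t_level N R \<theta>" if "1 \<le> \<theta>" for \<theta>
    using that by (intro c_star_le feas)
  have low: "ennreal (1 - 1 / l) * (1 / t_level N R (l * \<theta>)) \<le> c_star M X (\<theta> * V)" if "1 \<le> \<theta>" "1 < l" for \<theta> l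
    using that by (intro c_star_ge feas)
  show ?thesis
    using up low by (auto intro!: tendsto_1_by_sandwich[of "\<lambda>\<theta>. c_star M X (\<theta> * V)" "t_level N R"])
qed

end
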